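(* Consider the portfolio algorithm INOPA (described in the context) run with $M\ge 2$ solvers, a lag function $\mathrm{lag}$, and two non-decreasing integer sequences $(r_n)_{n\in\mathbb N^*}$ and $(s_n)_{n\in\mathbb N^*}$ (comparison times and numbers of resamplings). Assume that: (a) $\mathrm{Var}\, f(x)\le 1$ for all $x\in\mathcal D$; (b) for some positive sequence $(\epsilon_n)_{n\in\mathbb N^*}$, the property $P_{as}((\epsilon_n)_{n\in\mathbb N^*})$ (defined in the context) holds. Define $S=\{i\in\{1,\dots,M\}\mid \exists n_0\in\mathbb N^*,\ \forall n\ge n_0,\ \Delta_{i,n}<2\epsilon_n\}$ and let $M'=|S|$ be its cardinality. Then there exists $n_0$ such that for all $n\ge n_0$, $$SR^{Selection}_{r_n} < SR^{Solvers}_{r_n} + 2\epsilon_{r_n}$$ with probability at least $1-\frac{M}{s_n\,\epsilon_{\mathrm{lag}(r_n)}^2}$, after $$e_n = r_n\cdot M'\cdot\left(1+\frac{M}{M'}\sum_{i=1}^n\frac{s_i}{r_n}\right)+(M-M')\,\mathrm{lag}(r_n)$$ evaluations. Moreover, if $(s_n)$, $\mathrm{lag}$, $(r_n)$ and $(\epsilon_n)$ satisfy $\sum_{j=1}^{\infty}\frac{1}{s_j\,\epsilon_{\mathrm{lag}(r_j)}^2}<\infty$, $\mathrm{lag}(n)=o(n)$ and $\sum_{j=1}^n s_j=o(r_n)$, then, almost surely, there exists $n_0$ such that for all $n\ge n_0$, $$SR^{Selection}_{r_n} < SR^{Solvers}_{r_n} + 2\epsilon_{r_n}$$ after $e_n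 = r_n\cdot M'\cdot(1+o(1))$ evaluations.
   Context: $\mathbb N^*=\{1,2,3,\dots\}$. The objective is a noisy function $f$ on a domain $\mathcal D\subset\mathbb R^d$: each call at $x$ returns $f(x)=f(x,\omega)\in\mathbb R$ where $\omega$ is a random variable sampled independently at each call. The goal is to minimize $x\mapsto \mathbb E_\omega f(x,\omega)$, whose minimizer is $x^*$. For $s\in\mathbb N^*$, $\hat{\mathbb E}_s[f(x)]=\frac1s\sum_{j=1}^s f(x)^{(j)}$ is the average of $s$ independent evaluations of $f$ at $x$ (using fresh noise). There are $M\ge2$ solvers. $\tilde x_{i,n}\in\mathcal D$ is the (random) point recommended by solver $i\in\{1,\dots,M\}$ after it has spent $n$ function evaluations. Its simple regret is $SR_{i,n}=\mathbb E_\omega\left(f(\tilde x_{i,n},\omega)-f(x^*,\omega)\right)$, where the expectation is only over the fresh noise $\omega$, so that $SR_{i,n}$ is a random variable depending on $\tilde x_{i,n}$. Put $SR^{Solvers}_n=\min_{1\le i\le M}SR_{i,n}$ and $\Delta_{i,n}=SR_{i,n}-\min_{1\le j\le M}SR_{j,n}$. A lag function is a non-decreasing function $\mathrm{lag}:\mathbb N^*\to\mathbb N^*$ with $\mathrm{lag}(n)\le n$ for all $n$. INOPA (Improved Noisy Optimization Portfolio Algorithm): for $n=1,2,\dots$, each solver that has received fewer than $\mathrm{lag}(r_n)$ evaluations is run until it has received $\mathrm{lag}(r_n)$ evaluations. Then the $n$-th selection is made: $s_n$ fresh evaluations are spent at each of the points $\tilde x_{i,\mathrm{lag}(r_n)}$,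 $i=1,\dots,M$, and the selected solver is $i^*=i^*_{r_n}\in\arg\min_{i\in\{1,\dots,M\}}\hat{\mathbb E}_{s_n}[f(\tilde x_{i,\mathrm{lag}(r_n)})]$. Only the selected solver $i^*$ is then run further, so as to reach $r_n$ evaluations (and, subsequently, up to $r_{n+1}$ evaluations), and for $m\in\{r_n,\dots,r_{n+1}-1\}$ the portfolio recommends $\tilde x_{i^*,m}$. The other solvers receive no evaluations beyond those needed to reach the next lagged index $\mathrm{lag}(r_{n+1})$. The evaluations counted are those spent in running the solvers together with the $s_k$ comparison evaluations per solver at each selection $k$. The selection regret is $SR^{Selection}_{r_n}=\mathbb E_\omega\left(f(\tilde x_{i^*_{r_n},r_n},\omega)-f(x^*,\omega)\right)=SR_{i^*_{r_n},r_n}$. "After $e_n$ evaluations" refers to the total number of function evaluations spent when the recommendation $\tilde x_{i^*_{r_n},r_n}$ is made. Property $P_{as}((\epsilon_n)_{n\in\mathbb N^*})$: for every $i\in\{1,\dots,M\}$, almost surely, there exists $n_0$ such that for all $n_1\ge n_0$: $\Delta_{i,n_1}<2\epsilon_{n_1}$ implies that $\Delta_{i,n_2}<2\epsilon_{n_2}$ for all $n_2\ge n_1$.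
   Formalization: Added: lag(r_n)→∞. First part: probability is conditional on the solvers' points, n_0 may depend on them, and the e_n bound assumes earlier comparisons k<n with r_{k+1}>lag(r_n) met the regret bound. "After e_n evaluations" means at most e_n. The literal claim is false. *)

theory Defs
  imports "HOL-Probability.Probability" "HOL-Library.Landau_Symbols"
begin

text \<open>
  Solvers are numbered \<open>1, \<dots>, M\<close>. Sequences indexed by the positive integers are functions on
  \<^typ>\<open>nat\<close> whose value at 0 is irrelevant. \<open>N\<close> is the law of the noise of one call to the objective
  \<open>f x w\<close>; the algorithm itself runs on a probability space with outcomes \<open>\<omega>\<close>.
\<close>

section \<open>Regrets\<close>

definition simple_regret ::
  "'w measure \<Rightarrow> ('a \<Rightarrow> 'w \<Rightarrow> real) \<Rightarrow> 'a \<Rightarrow> (nat \<Rightarrow> nat \<Rightarrow> 'o \<Rightarrow> 'a) \<Rightarrow> 'o \<Rightarrow> nat \<Rightarrow> nat \<Rightarrow> real"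
  where "simple_regret N f xstar xt \<omega> i n = (LINT w|N. f (xt i n \<omega>) w - f xstar w)"

text \<open>In the following, \<open>R i n\<close> is the simple regret of solver \<open>i\<close> after \<open>n\<close> evaluations, for a
  fixed outcome.\<close>

definition solvers_regret :: "nat \<Rightarrow> (nat \<Rightarrow> nat \<Rightarrow> real) \<Rightarrow> nat \<Rightarrow> real"
  where "solvers_regret M R n = Min ((\<lambda>i. R i n) ` {1..M})"

definition regret_gap :: "nat \<Rightarrow> (nat \<Rightarrow> nat \<Rightarrow> real) \<Rightarrow> nat \<Rightarrow> nat \<Rightarrow> real"
  where "regret_gap M R i n = R i n - solvers_regret M R n"

definition near_optimal_solvers :: "nat \<Rightarrow> (nat \<Rightarrow> real) \<Rightarrow> (nat \<Rightarrow> nat \<Rightarrow> real) \<Rightarrow> nat set"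
  where "near_optimal_solvers M \<epsilon> R =
    {i \<in> {1..M}. \<exists>n0\<ge>1. \<forall>n\<ge>n0. regret_gap M R i n < 2 * \<epsilon> n}"

definition P_as :: "'o measure \<Rightarrow> nat \<Rightarrow> ('o \<Rightarrow> nat \<Rightarrow> nat \<Rightarrow> real) \<Rightarrow> (nat \<Rightarrow> real) \<Rightarrow> bool"
  where "P_as P M R \<epsilon> \<longleftrightarrow> (\<forall>i\<in>{1..M}. AE \<omega> in P. \<exists>n0\<ge>1. \<forall>n1\<ge>n0.
    regret_gap M (R \<omega>) i n1 < 2 * \<epsilon> n1 \<longrightarrow> (\<forall>n2\<ge>n1. regret_gap M (R \<omega>) i n2 < 2 * \<epsilon> n2))"

section \<open>The portfolio algorithm\<close>

definition lag_function :: "(nat \<Rightarrow> nat) \<Rightarrow> bool"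
  where "lag_function lag \<longleftrightarrow> mono_on {1..} lag \<and> (\<forall>n\<ge>1. 1 \<le> lag n \<and> lag n \<le> n)"

text \<open>\<open>W n i j\<close> is the noise of the \<open>j\<close>-th of the \<open>s n\<close> evaluations spent on solver \<open>i\<close> at the
  \<open>n\<close>-th comparison.\<close>

definition empirical_mean ::
  "('a \<Rightarrow> 'w \<Rightarrow> real) \<Rightarrow> (nat \<Rightarrow> nat \<Rightarrow> nat \<Rightarrow> 'o \<Rightarrow> 'w) \<Rightarrow> (nat \<Rightarrow> nat) \<Rightarrow> nat \<Rightarrow> nat \<Rightarrow> 'o \<Rightarrow> 'a \<Rightarrow> real"
  where "empirical_mean f W s n i \<omega> x = (\<Sum>j=1..s n. f x (W n i j \<omega>)) / real (s n)"

definition comparison_indices :: "nat \<Rightarrow> (nat \<Rightarrow> nat) \<Rightarrow> (nat \<times> nat \<times> nat) set"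
  where "comparison_indices M s = {(n, i, j). 1 \<le> n \<and> i \<in> {1..M} \<and> j \<in> {1..s n}}"

text \<open>The \<open>\<sigma>\<close>-algebra generated by all comparison noises, and the one generated by all the points
  that the solvers recommend.\<close>

definition comparison_algebra ::
  "'o measure \<Rightarrow> 'w measure \<Rightarrow> nat \<Rightarrow> (nat \<Rightarrow> nat) \<Rightarrow> (nat \<Rightarrow> nat \<Rightarrow> nat \<Rightarrow> 'o \<Rightarrow> 'w) \<Rightarrow> 'o measure"
  where "comparison_algebra P N M s W =
    vimage_algebra (space P)
      (\<lambda>\<omega>. \<lambda>(n, i, j)\<in>comparison_indices M s. W n i j \<omega>)
      (Pi\<^sub>M (comparison_indices M s) (\<lambda>_. N))"

definition solver_algebra ::
  "'o measure \<Rightarrow> 'a::euclidean_space set \<Rightarrow> nat \<Rightarrow> (nat \<Rightarrow> nat \<Rightarrow> 'o \<Rightarrow> 'a) \<Rightarrow> 'o measure"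
  where "solver_algebra P D M xt =
    vimage_algebra (space P)
      (\<lambda>\<omega>. \<lambda>(i, n)\<in>{1..M} \<times> {1..}. xt i n \<omega>)
      (Pi\<^sub>M ({1..M} \<times> {1..}) (\<lambda>_. restrict_space borel D))"

text \<open>\<open>sel n\<close> is the (random) solver selected at the \<open>n\<close>-th comparison. How ties are broken is left
  open, so \<open>sel\<close> is any measurable choice among the minimizers.\<close>

definition inopa_selection ::
  "'o measure \<Rightarrow> ('a \<Rightarrow> 'w \<Rightarrow> real) \<Rightarrow> nat \<Rightarrow> (nat \<Rightarrow> nat) \<Rightarrow> (nat \<Rightarrow> nat) \<Rightarrow> (nat \<Rightarrow> nat) \<Rightarrow>
    (nat \<Rightarrow> nat \<Rightarrow> 'o \<Rightarrow> 'a) \<Rightarrow> (nat \<Rightarrow> nat \<Rightarrow> nat \<Rightarrow> 'o \<Rightarrow> 'w) \<Rightarrow> (nat \<Rightarrow> 'o \<Rightarrow> nat) \<Rightarrow> bool"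
  where "inopa_selection P f M lag r s xt W sel \<longleftrightarrow>
    (\<forall>n\<ge>1. sel n \<in> measurable P (count_space UNIV) \<and>
      (\<forall>\<omega>\<in>space P.
        is_arg_min (\<lambda>i. empirical_mean f W s n i \<omega> (xt i (lag (r n)) \<omega>)) (\<lambda>i. i \<in> {1..M})
          (sel n \<omega>)))"

text \<open>Below, \<open>c n\<close> is the solver selected at the \<open>n\<close>-th comparison for a fixed outcome.
  If solver \<open>i\<close> has received \<open>k i\<close> evaluations before stage \<open>n\<close>, then \<open>stage_evals lag r c n t k i\<close>
  is the number it has received once all solvers have been brought up to the lagged index and the
  selected one has been run up to \<open>t\<close> evaluations.\<close>

definition stage_evals ::
  "(nat \<Rightarrow> nat) \<Rightarrow> (nat \<Rightarrow> nat) \<Rightarrow> (nat \<Rightarrow> nat) \<Rightarrow> nat \<Rightarrow> nat \<Rightarrow> (nat \<Rightarrow> nat) \<Rightarrow> nat \<Rightarrow> nat"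
  where "stage_evals lag r c n t k i =
    (let k' = max (k i) (lag (r n)) in if i = c n then max k' t else k')"

text \<open>Evaluations received by each solver when stage \<open>n\<close> is over, i.e. when the solver selected at
  the \<open>n\<close>-th comparison has been run up to \<open>r (n + 1)\<close> evaluations.\<close>

primrec evals_after_stage ::
  "(nat \<Rightarrow> nat) \<Rightarrow> (nat \<Rightarrow> nat) \<Rightarrow> (nat \<Rightarrow> nat) \<Rightarrow> nat \<Rightarrow> nat \<Rightarrow> nat"
  where
    "evals_after_stage lag r c 0 = (\<lambda>_. 0)"
  | "evals_after_stage lag r c (Suc n) =
      stage_evals lag r c (Suc n) (r (Suc (Suc n))) (evals_after_stage lag r c n)"

text \<open>All evaluations spent (solver runs and comparisons) when the point found by the \<open>n\<close>-th
  selected solver after \<open>r n\<close> evaluations is recommended.\<close>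

definition total_evals ::
  "nat \<Rightarrow> (nat \<Rightarrow> nat) \<Rightarrow> (nat \<Rightarrow> nat) \<Rightarrow> (nat \<Rightarrow> nat) \<Rightarrow> (nat \<Rightarrow> nat) \<Rightarrow> nat \<Rightarrow> nat"
  where "total_evals M lag r s c n =
    (\<Sum>i=1..M. stage_evals lag r c n (r n) (evals_after_stage lag r c (n - 1)) i)
      + M * (\<Sum>k=1..n. s k)"

section \<open>Notions of the conclusion\<close>

definition selection_regret :: "(nat \<Rightarrow> nat) \<Rightarrow> (nat \<Rightarrow> nat \<Rightarrow> real) \<Rightarrow> (nat \<Rightarrow> nat) \<Rightarrow> nat \<Rightarrow> real"
  where "selection_regret r R c n = R (c n) (r n)"

definition selection_success ::
  "nat \<Rightarrow> (nat \<Rightarrow> real) \<Rightarrow> (nat \<Rightarrow> nat) \<Rightarrow> (nat \<Rightarrow> nat \<Rightarrow> real) \<Rightarrow> (nat \<Rightarrow> nat) \<Rightarrow> nat \<Rightarrow> bool"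
  where "selection_success M \<epsilon> r R c n \<longleftrightarrow>
    selection_regret r R c n < solvers_regret M R (r n) + 2 * \<epsilon> (r n)"

text \<open>The budget as a function of the number \<open>M'\<close> of near-optimal solvers.\<close>

definition eval_budget ::
  "nat \<Rightarrow> nat \<Rightarrow> (nat \<Rightarrow> nat) \<Rightarrow> (nat \<Rightarrow> nat) \<Rightarrow> (nat \<Rightarrow> nat) \<Rightarrow> nat \<Rightarrow> real"
  where "eval_budget M M' lag r s n =
    real (r n) * real M' * (1 + real M / real M' * (\<Sum>i=1..n. real (s i) / real (r n)))
      + (real M - real M') * real (lag (r n))"

definition sigma_cond_prob :: "'o measure \<Rightarrow> 'o measure \<Rightarrow> ('o \<Rightarrow> bool) \<Rightarrow> 'o \<Rightarrow> real"
  where "sigma_cond_prob P F Q = real_cond_exp P F (indicator {\<omega> \<in> space P. Q \<omega>})"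

end

theory Submission
  imports Defs
begin

text \<open>
  Conditionally on the solvers, the comparison noise is still an independent sample, so Chebyshev's
  inequality and a union bound show that, except with probability \<open>M / (s n * \<epsilon>\<^sup>2)\<close> where
  \<open>\<epsilon> = \<epsilon> (lag (r n))\<close>, all empirical means of the \<open>n\<close>-th comparison are accurate up to \<open>\<epsilon>\<close>. The
  selected solver then has a gap below \<open>2 * \<epsilon>\<close> at the lagged index, and the stability property
  carries this over to \<open>r n\<close> and puts the solver in the near-optimal set. A solver outside this set
  is therefore never run beyond the lagged index, which gives the budget. If the failure
  probabilities are summable, the Borel--Cantelli lemma gives accuracy at all late comparisons.
\<close>

section \<open>Probability preliminaries: variance of independent sums, conditioning by
  freezing\<close>

text \<open>Induction over the index set: a new summand is independent of the sum of the others, so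
  the expectation of their product factorizes and the covariance vanishes. Square integrability of
  the sum belongs to the conclusion because the induction step and Chebyshev's inequality both need
  it.\<close>

lemma (in prob_space) variance_sum_indep_vars:
  fixes X :: "'i \<Rightarrow> 'a \<Rightarrow> real"
  assumes "finite I" and "indep_vars (\<lambda>_. borel) X I"
    and "\<And>i. i \<in> I \<Longrightarrow> integrable M (\<lambda>\<omega>. (X i \<omega>)\<^sup>2)"
  shows "integrable M (\<lambda>\<omega>. (\<Sum>i\<in>I. X i \<omega>)\<^sup>2) \<and>
    variance (\<lambda>\<omega>. \<Sum>i\<in>I. X i \<omega>) = (\<Sum>i\<in>I. variance (X i))"
  using assms
proof (induction I rule: finite_induct)
  case empty
  show ?case by simp
next
  case (insert a I)
  let ?S = "\<lambda>\<omega>. \<Sum>i\<in>I. X i \<omega>"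
  have rv [measurable]: "X i \<in> borel_measurable M" if "i \<in> insert a I" for i
    using insert.prems(1) that by (auto simp: indep_vars_def)
  have sq_a: "integrable M (\<lambda>\<omega>. (X a \<omega>)\<^sup>2)" by (rule insert.prems) simp
  have IH: "integrable M (\<lambda>\<omega>. (?S \<omega>)\<^sup>2)" "variance ?S = (\<Sum>i\<in>I. variance (X i))"
    using insert.IH[OF indep_vars_subset[OF insert.prems(1)]] insert.prems(2) by auto
  have S_meas [measurable]: "?S \<in> borel_measurable M"
    by (rule borel_measurable_sum) (rule rv, simp)
  have a_meas [measurable]: "X a \<in> borel_measurable M" by (rule rv) simp
  have int_a: "integrable M (X a)" and int_S: "integrable M ?S"
    using sq_a IH(1) by (auto intro: square_integrable_imp_integrable)
  have ind: "indep_var borel (X a) borel ?S"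
    by (rule indep_vars_sum[OF insert.hyps insert.prems(1)])
  have prod: "integrable M (\<lambda>\<omega>. X a \<omega> * ?S \<omega>)"
    "expectation (\<lambda>\<omega>. X a \<omega> * ?S \<omega>) = expectation (X a) * expectation ?S"
    by (rule indep_var_integrable[OF ind int_a int_S] indep_var_lebesgue_integral[OF ind int_a int_S])+
  have sq: "(X a \<omega> + ?S \<omega>)\<^sup>2 = (X a \<omega>)\<^sup>2 + 2 * (X a \<omega> * ?S \<omega>) + (?S \<omega>)\<^sup>2" for \<omega>
    by (simp add: power2_sum)
  have int_sq: "integrable M (\<lambda>\<omega>. (X a \<omega> + ?S \<omega>)\<^sup>2)"
    unfolding sq using sq_a prod(1) IH(1) by auto
  have "variance (\<lambda>\<omega>. X a \<omega> + ?S \<omega>) = variance (X a) + variance ?S"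
    using int_a int_S int_sq sq_a IH(1) prod
    by (simp add: variance_eq sq) (simp add: power2_eq_square algebra_simps prob_space)
  then show ?case using insert.hyps int_sq IH(2) by simp
qed

text \<open>Since \<open>Y\<close> is independent of \<open>F\<close>, conditioning on
  \<open>F\<close> freezes the first argument of \<open>h\<close> and leaves an average over the law
  of \<open>Y\<close>. This turns a bound valid for every fixed outcome of the solvers into a bound
  on a conditional probability.\<close>

lemma (in prob_space) real_cond_exp_freeze:
  assumes sub: "subalgebra M F" and Y [measurable]: "random_variable T Y"
    and ind: "indep_set (sets F) (sets (vimage_algebra (space M) Y T))"
    and h [measurable]: "Measurable.pred (F \<Otimes>\<^sub>M T) (\<lambda>(x, y). h x y)"
  shows "AE \<omega> in M. real_cond_exp M F (indicator {\<omega> \<in> space M. h \<omega> (Y \<omega>)}) \<omega> =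
    prob {\<omega>' \<in> space M. h \<omega> (Y \<omega>')}"
proof -
  \<comment> \<open>The identity, seen as a map into the coarser space \<open>F\<close>, serves as a
    random variable generating \<open>F\<close>. Independence of two algebras thereby becomes a
    statement about the joint law of this map and \<open>Y\<close>.\<close>
  have id_meas [measurable]: "(\<lambda>\<omega>. \<omega>) \<in> measurable M F"
    using measurable_from_subalg[OF sub, of "\<lambda>\<omega>. \<omega>" F] by simp
  have spF: "space F = space M" using sub by (simp add: subalgebra_def)
  interpret FM: finite_measure_subalgebra M F by unfold_locales (rule sub)
  interpret X: prob_space "distr M F (\<lambda>\<omega>. \<omega>)" by (rule prob_space_distr) simp
  interpret Y: prob_space "distr M T Y" by (rule prob_space_distr) simp
  interpret XY: pair_prob_space "distr M F (\<lambda>\<omega>. \<omega>)" "distr M T Y" ..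
  \<comment> \<open>Independence gives the product formula on rectangles, and these determine the
    joint law.\<close>
  have joint: "distr M F (\<lambda>\<omega>. \<omega>) \<Otimes>\<^sub>M distr M T Y = distr M (F \<Otimes>\<^sub>M T) (\<lambda>\<omega>. (\<omega>, Y \<omega>))"
  proof (rule pair_measure_eqI)
    fix A B
    assume "A \<in> sets (distr M F (\<lambda>\<omega>. \<omega>))" and "B \<in> sets (distr M T Y)"
    then have A: "A \<in> sets F" and B: "B \<in> sets T" by simp_all
    have AM: "A \<inter> space M = A" using sets.sets_into_space[OF A] spF by auto
    have eq: "(\<lambda>\<omega>. (\<omega>, Y \<omega>)) -` (A \<times> B) \<inter> space M = A \<inter> (Y -` B \<inter> space M)" by auto
    have "prob (A \<inter> (Y -` B \<inter> space M)) = prob A * prob (Y -` B \<inter> space M)"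
      by (rule indep_setD[OF ind A in_vimage_algebra[OF B]])
    then show "emeasure (distr M F (\<lambda>\<omega>. \<omega>)) A * emeasure (distr M T Y) B =
        emeasure (distr M (F \<Otimes>\<^sub>M T) (\<lambda>\<omega>. (\<omega>, Y \<omega>))) (A \<times> B)"
      using A B by (simp add: emeasure_distr eq AM emeasure_eq_measure ennreal_mult)
  qed (simp_all add: X.sigma_finite_measure_axioms Y.sigma_finite_measure_axioms cong: sets_pair_measure_cong)
  define g where "g x = prob {\<omega>' \<in> space M. h x (Y \<omega>')}" for x
  have g_eq: "g x = (\<integral>y. indicator {(x, y). h x y} (x, y) \<partial>distr M T Y)" if "x \<in> space F" for x
  proof -
    have [measurable]: "Measurable.pred T (h x)"
      using measurable_compose_Pair1[OF that h] by simp
    have "(\<lambda>y. if h x y then 1 else 0 :: real) \<in> borel_measurable T" by measurable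
    then have "(\<integral>y. indicator {(x, y). h x y} (x, y) \<partial>distr M T Y) =
        (\<integral>\<omega>'. (if h x (Y \<omega>') then 1 else 0 :: real) \<partial>M)"
      by (simp add: indicator_def of_bool_def integral_distr)
    also have "\<dots> = (\<integral>\<omega>'. indicator {\<omega>' \<in> space M. h x (Y \<omega>')} \<omega>' \<partial>M)"
      by (rule Bochner_Integration.integral_cong) (auto simp: indicator_def)
    also have "\<dots> = g x" unfolding g_def
      by (subst Bochner_Integration.integral_indicator) (auto intro: arg_cong[where f=prob])
    finally show ?thesis ..
  qed
  have ind_meas [measurable]: "(indicator {(x, y). h x y} :: _ \<Rightarrow> real) \<in> borel_measurable (F \<Otimes>\<^sub>M T)"
  proof -
    have "(\<lambda>p. if (case p of (x, y) \<Rightarrow> h x y) then 1 else 0 :: real) \<in> borel_measurable (F \<Otimes>\<^sub>M T)"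
      by measurable
    also have "(\<lambda>p. if (case p of (x, y) \<Rightarrow> h x y) then 1 else 0 :: real) = indicator {(x, y). h x y}"
      by (auto simp: indicator_def fun_eq_iff)
    finally show ?thesis .
  qed
  have g_meas: "g \<in> borel_measurable F"
  proof -
    have "(\<lambda>x. \<integral>y. indicator {(x, y). h x y} (x, y) \<partial>distr M T Y) \<in> (borel_measurable F :: (_ \<Rightarrow> real) set)"
      by (rule Y.borel_measurable_lebesgue_integral) (simp add: ind_meas cong: measurable_cong_sets)
    then show ?thesis by (subst measurable_cong[OF g_eq])
  qed
  note gM = measurable_from_subalg[OF sub g_meas]
  have ev [measurable]: "{\<omega> \<in> space M. h \<omega> (Y \<omega>)} \<in> events"
  proof -
    have "(\<lambda>\<omega>. (\<omega>, Y \<omega>)) \<in> measurable M (F \<Otimes>\<^sub>M T)" by measurable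
    from measurable_compose[OF this h] show ?thesis by simp
  qed
  have "AE \<omega> in M. real_cond_exp M F (indicator {\<omega> \<in> space M. h \<omega> (Y \<omega>)}) \<omega> = g \<omega>"
  proof (rule FM.real_cond_exp_charact)
    show "integrable M (indicator {\<omega> \<in> space M. h \<omega> (Y \<omega>)} :: _ \<Rightarrow> real)"
      by (rule integrable_const_bound[where B=1]) (use ev in \<open>auto simp: indicator_def\<close>)
    show "integrable M g"
      by (rule integrable_const_bound[where B=1]) (use gM in \<open>auto simp: g_def\<close>)
    show "g \<in> borel_measurable F" by (rule g_meas)
    fix A assume A [measurable]: "A \<in> sets F"
    \<comment> \<open>To test \<open>g\<close> against a set \<open>A\<close> of \<open>F\<close>,
      the indicator of \<open>A\<close> is carried along as a function of the first coordinate.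
      Fubini's theorem then integrates out \<open>Y\<close> and leaves \<open>g\<close> on
      \<open>A\<close>.\<close>
    let ?k = "\<lambda>p. indicator A (fst p) * indicator {(x, y). h x y} p :: real"
    have k_meas: "?k \<in> borel_measurable (F \<Otimes>\<^sub>M T)" by measurable
    have k_int: "integrable (distr M F (\<lambda>\<omega>. \<omega>) \<Otimes>\<^sub>M distr M T Y) ?k"
      by (rule XY.integrable_const_bound[where B=1])
        (use k_meas in \<open>auto simp: indicator_def cong: measurable_cong_sets\<close>)
    have "(\<integral>\<omega>\<in>A. indicator {\<omega> \<in> space M. h \<omega> (Y \<omega>)} \<omega> \<partial>M) = (\<integral>\<omega>. ?k (\<omega>, Y \<omega>) \<partial>M)"
      unfolding set_lebesgue_integral_def
      by (rule Bochner_Integration.integral_cong) (auto simp: indicator_def)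
    also have "\<dots> = (\<integral>p. ?k p \<partial>(distr M F (\<lambda>\<omega>. \<omega>) \<Otimes>\<^sub>M distr M T Y))"
      unfolding joint by (rule integral_distr[symmetric]) (use k_meas in measurable)
    also have "\<dots> = (\<integral>x. (\<integral>y. ?k (x, y) \<partial>distr M T Y) \<partial>distr M F (\<lambda>\<omega>. \<omega>))"
      by (rule XY.integral_fst'[OF k_int, symmetric])
    also have "\<dots> = (\<integral>x. indicator A x * g x \<partial>distr M F (\<lambda>\<omega>. \<omega>))"
      by (rule Bochner_Integration.integral_cong) (auto simp: g_eq)
    also have "\<dots> = (\<integral>\<omega>\<in>A. g \<omega> \<partial>M)"
      unfolding set_lebesgue_integral_def
      by (subst integral_distr) (use g_meas in auto)
    finally show "(\<integral>\<omega>\<in>A. indicator {\<omega> \<in> space M. h \<omega> (Y \<omega>)} \<omega> \<partial>M) = (\<integral>\<omega>\<in>A. g \<omega> \<partial>M)" .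
  qed
  then show ?thesis unfolding g_def .
qed

section \<open>Counting evaluations and the size of the budget\<close>

lemma near_optimal_solvers_subset: "near_optimal_solvers M \<epsilon> R \<subseteq> {1..M}"
  by (auto simp: near_optimal_solvers_def)

text \<open>The count of a solver is a running maximum of its targets: all lagged indices so far,
  and \<open>r (Suc k)\<close> for each stage \<open>k\<close> at which it was selected. A common
  bound of the targets therefore bounds the count.\<close>

lemma evals_after_stage_le:
  assumes "\<And>k. k \<in> {1..n} \<Longrightarrow> lag (r k) \<le> b" and "\<And>k. k \<in> {1..n} \<Longrightarrow> c k = i \<Longrightarrow> r (Suc k) \<le> b"
  shows "evals_after_stage lag r c n i \<le> b"
  using assms by (induction n) (auto simp: stage_evals_def Let_def)

text \<open>No target up to this recommendation exceeds \<open>r n\<close>, and a solver outside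
  \<open>S\<close> was selected only at stages whose target is at most \<open>lag (r n)\<close>.
  Such selections cost nothing beyond what every solver receives anyway, which is why
  \<open>early\<close> constrains only the stages with a larger target.\<close>

lemma total_evals_le:
  assumes lag: "lag_function lag" and r: "mono_on {1..} r" "\<And>n. n \<ge> 1 \<Longrightarrow> r n \<ge> 1"
    and S: "S \<subseteq> {1..M}" and n: "n \<ge> 1" "c n \<in> S"
    and early: "\<And>k. k \<in> {1..<n} \<Longrightarrow> lag (r n) < r (Suc k) \<Longrightarrow> c k \<in> S"
  shows "total_evals M lag r s c n
    \<le> card S * r n + (M - card S) * lag (r n) + M * (\<Sum>k=1..n. s k)"
proof -
  let ?e = "\<lambda>i. stage_evals lag r c n (r n) (evals_after_stage lag r c (n - 1)) i"
  have r_le: "r k \<le> r n" if "k \<in> {1..n}" for k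
    by (rule mono_onD[OF r(1)]) (use that in auto)
  have lag_le: "lag (r k) \<le> lag (r n)" if "k \<in> {1..n}" for k
  proof (rule mono_onD[of "{1..}" lag])
    show "mono_on {1..} lag" using lag by (simp add: lag_function_def)
    show "r k \<in> {1..}" "r n \<in> {1..}" using r(2)[of k] r(2)[of n] that by auto
    show "r k \<le> r n" using r_le that .
  qed
  have lag_r: "lag (r n) \<le> r n" using lag r(2)[OF n(1)] by (simp add: lag_function_def)
  have in_S: "?e i \<le> r n" for i
  proof -
    have "evals_after_stage lag r c (n - 1) i \<le> r n"
    proof (rule evals_after_stage_le)
      fix k assume k: "k \<in> {1..n - 1}"
      then have "k \<in> {1..n}" by auto
      then show "lag (r k) \<le> r n" using lag_le lag_r le_trans by blast
      \<comment> \<open>Only stages up to \<open>n - 1\<close> are complete here, so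
        \<open>Suc k\<close> is at most \<open>n\<close>.\<close>
      show "r (Suc k) \<le> r n" using k by (intro r_le) auto
    qed
    then show ?thesis using lag_r by (auto simp: stage_evals_def Let_def)
  qed
  have out_S: "?e i \<le> lag (r n)" if i: "i \<notin> S" for i
  proof -
    have "evals_after_stage lag r c (n - 1) i \<le> lag (r n)"
    proof (rule evals_after_stage_le)
      fix k assume k: "k \<in> {1..n - 1}"
      then show "lag (r k) \<le> lag (r n)" by (intro lag_le) auto
      assume "c k = i"
      then show "r (Suc k) \<le> lag (r n)" using early[of k] k i by force
    qed
    \<comment> \<open>As \<open>c n\<close> lies in \<open>S\<close>, solver \<open>i\<close> is not
      the one run up to \<open>r n\<close> at stage \<open>n\<close>.\<close>
    then show ?thesis using i n(2) by (auto simp: stage_evals_def Let_def)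
  qed
  have fin: "finite S" using S finite_subset by blast
  have "(\<Sum>i=1..M. ?e i) = (\<Sum>i\<in>S. ?e i) + (\<Sum>i\<in>{1..M} - S. ?e i)"
    using S by (simp add: sum.subset_diff)
  also have "\<dots> \<le> card S * r n + card ({1..M} - S) * lag (r n)"
    using sum_bounded_above[of S ?e "r n"] sum_bounded_above[of "{1..M} - S" ?e "lag (r n)"]
      in_S out_S by fastforce
  also have "card ({1..M} - S) = M - card S" using S fin by (simp add: card_Diff_subset)
  finally show ?thesis unfolding total_evals_def by simp
qed

text \<open>Both denominators cancel against the factors in front. Positivity matters: with
  \<open>r n = 0\<close> or \<open>M' = 0\<close> the leading product is zero and the cost of the
  comparisons would drop out of the budget.\<close>

lemma eval_budget_eq:
  assumes "r n \<ge> 1" and "M' \<ge> 1"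
  shows "eval_budget M M' lag r s n =
    real (r n) * real M' + real M * (\<Sum>i=1..n. real (s i)) + (real M - real M') * real (lag (r n))"
proof -
  have "(\<Sum>i=1..n. real (s i) / real (r n)) = (\<Sum>i=1..n. real (s i)) / real (r n)"
    by (simp add: sum_divide_distrib)
  then show ?thesis using assms by (simp add: eval_budget_def field_simps)
qed

lemma total_evals_le_budget:
  assumes "lag_function lag" and "mono_on {1..} r" and "\<And>n. n \<ge> 1 \<Longrightarrow> r n \<ge> 1"
    and S: "S \<subseteq> {1..M}" and n: "n \<ge> 1" "c n \<in> S"
    and "\<And>k. k \<in> {1..<n} \<Longrightarrow> lag (r n) < r (Suc k) \<Longrightarrow> c k \<in> S"
  shows "real (total_evals M lag r s c n) \<le> eval_budget M (card S) lag r s n"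
proof -
  have fin: "finite S" using S finite_subset by blast
  \<comment> \<open>This bound makes the truncated subtraction \<open>M - card S\<close> agree with
    the real one in the budget; the next line makes the budget formula applicable.\<close>
  have "card S \<le> M" using card_mono[OF _ S] by simp
  moreover have "card S \<ge> 1" using fin n(2) by (metis Suc_le_eq One_nat_def card_gt_0_iff empty_iff)
  moreover have "real (total_evals M lag r s c n)
      \<le> real (card S * r n + (M - card S) * lag (r n) + M * (\<Sum>k=1..n. s k))"
    unfolding of_nat_le_iff by (rule total_evals_le) (use assms in auto)
  ultimately show ?thesis using assms(3)[OF n(1)]
    by (simp add: eval_budget_eq of_nat_diff mult.commute)
qed

text \<open>The surplus over \<open>r n * M'\<close> consists of the resamplings and of the lagged
  indices, and both are of smaller order than \<open>r n\<close>.\<close>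

lemma eval_budget_asymp_equiv:
  assumes "\<And>n. n \<ge> 1 \<Longrightarrow> r n \<ge> 1" and r_lim: "filterlim r at_top sequentially" and M': "M' \<ge> 1"
    and lag: "(\<lambda>n. real (lag n)) \<in> o(\<lambda>n. real n)"
    and s: "(\<lambda>n. \<Sum>j=1..n. real (s j)) \<in> o(\<lambda>n. real (r n))"
  shows "(\<lambda>n. eval_budget M M' lag r s n) \<sim>[sequentially] (\<lambda>n. real (r n) * real M')"
proof -
  \<comment> \<open>The estimate for \<open>lag\<close> may be composed with \<open>r\<close>
    because \<open>r\<close> tends to infinity.\<close>
  have lag': "(\<lambda>n. real (lag (r n))) \<in> o(\<lambda>n. real (r n))"
    by (rule landau_o.small.compose[OF lag r_lim])
  have "(\<lambda>n. real M * (\<Sum>i=1..n. real (s i)) + (real M - real M') * real (lag (r n)))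
      \<in> o(\<lambda>n. real (r n))"
    using s lag' by (intro sum_in_smallo) simp_all
  then have o: "(\<lambda>n. real M * (\<Sum>i=1..n. real (s i)) + (real M - real M') * real (lag (r n)))
      \<in> o(\<lambda>n. real (r n) * real M')"
    using M' by simp
  have "(\<lambda>n. real (r n) * real M' + (real M * (\<Sum>i=1..n. real (s i)) +
        (real M - real M') * real (lag (r n)))) \<sim>[sequentially] (\<lambda>n. real (r n) * real M')"
    using o by (simp add: asymp_equiv_add_right)
  moreover have "\<forall>\<^sub>F n in sequentially. eval_budget M M' lag r s n =
      real (r n) * real M' + (real M * (\<Sum>i=1..n. real (s i)) + (real M - real M') * real (lag (r n)))"
    using eventually_ge_at_top[of 1]
    by eventually_elim (use assms(1) M' in \<open>simp add: eval_budget_eq add.assoc\<close>)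
  ultimately show ?thesis
    by (subst asymp_equiv_cong) (assumption, rule eventuallyI, rule refl)
qed

section \<open>Stability from a fixed threshold\<close>

text \<open>One threshold for all solvers, kept as a parameter: for each fixed \<open>k\<close>
  \<ge> 1 the stable outcomes form an event of the solver algebra, and under \<open>P_as\<close>
  countably many \<open>k\<close> cover almost every outcome.\<close>

definition stable_from :: "nat \<Rightarrow> (nat \<Rightarrow> real) \<Rightarrow> (nat \<Rightarrow> nat \<Rightarrow> real) \<Rightarrow> nat \<Rightarrow> bool"
  where "stable_from M \<epsilon> R k \<longleftrightarrow> (\<forall>i\<in>{1..M}. \<forall>n1\<ge>k. regret_gap M R i n1 < 2 * \<epsilon> n1 \<longrightarrow>
    (\<forall>n2\<ge>n1. regret_gap M R i n2 < 2 * \<epsilon> n2))"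

text \<open>There are finitely many solvers, so their exceptional null sets can be united and the
  largest of their thresholds serves all of them.\<close>

lemma AE_stable_from:
  assumes "P_as P M R \<epsilon>"
  shows "AE \<omega> in P. \<exists>k\<ge>1. stable_from M \<epsilon> (R \<omega>) k"
proof -
  have "AE \<omega> in P. \<forall>i\<in>{1..M}. \<exists>n0\<ge>1. \<forall>n1\<ge>n0.
      regret_gap M (R \<omega>) i n1 < 2 * \<epsilon> n1 \<longrightarrow> (\<forall>n2\<ge>n1. regret_gap M (R \<omega>) i n2 < 2 * \<epsilon> n2)"
    using assms unfolding P_as_def by (subst AE_ball_countable) auto
  then show ?thesis
  proof eventually_elim
    case (elim \<omega>)
    then obtain n0 where n0: "\<And>i. i \<in> {1..M} \<Longrightarrow> \<forall>n1\<ge>n0 i.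
      regret_gap M (R \<omega>) i n1 < 2 * \<epsilon> n1 \<longrightarrow> (\<forall>n2\<ge>n1. regret_gap M (R \<omega>) i n2 < 2 * \<epsilon> n2)"
      by metis
    \<comment> \<open>Inserting 1 keeps the threshold positive and the set nonempty.\<close>
    let ?k = "Max (insert 1 (n0 ` {1..M}))"
    have "n0 i \<le> ?k" if "i \<in> {1..M}" for i using that by (intro Max_ge) auto
    then have "stable_from M \<epsilon> (R \<omega>) ?k"
      unfolding stable_from_def using n0 by (meson le_trans)
    moreover have "?k \<ge> 1" by (intro Max_ge) auto
    ultimately show ?case by blast
  qed
qed

text \<open>Membership concerns all late times, but under stability a small gap at a single time
  past \<open>k\<close> persists.\<close>

lemma near_optimal_solversI:
  assumes "stable_from M \<epsilon> R k" and "i \<in> {1..M}" and "k \<ge> 1" "n \<ge> k"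
    and "regret_gap M R i n < 2 * \<epsilon> n"
  shows "i \<in> near_optimal_solvers M \<epsilon> R"
proof -
  have "\<forall>n2\<ge>n. regret_gap M R i n2 < 2 * \<epsilon> n2" using assms by (auto simp: stable_from_def)
  moreover have "n \<ge> 1" using assms by simp
  ultimately show ?thesis using assms(2) unfolding near_optimal_solvers_def by blast
qed

lemma selection_success_iff:
  "selection_success M \<epsilon> r R c n \<longleftrightarrow> regret_gap M R (c n) (r n) < 2 * \<epsilon> (r n)"
  by (auto simp: selection_success_def selection_regret_def regret_gap_def)

lemma solvers_regret_attained:
  assumes "M \<ge> 1"
  shows "\<exists>j\<in>{1..M}. solvers_regret M R' n = R' j n"
proof -
  have "Min ((\<lambda>i. R' i n) ` {1..M}) \<in> (\<lambda>i. R' i n) ` {1..M}" using assms by (intro Min_in) auto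
  then show ?thesis by (auto simp: solvers_regret_def)
qed

section \<open>The setting and its measurability\<close>

text \<open>The stability property stays outside and is assumed only by the two final lemmas. The
  divergence in \<open>lag_lim\<close> lets the lagged comparison times pass any stability
  threshold.\<close>

locale inopa_run = P: prob_space P + noise: prob_space N
  for P :: "'o measure" and N :: "'w measure" +
  fixes D :: "'a::euclidean_space set" and f :: "'a \<Rightarrow> 'w \<Rightarrow> real" and xstar :: 'a
    and M :: nat and lag r s :: "nat \<Rightarrow> nat" and \<epsilon> :: "nat \<Rightarrow> real"
    and xt :: "nat \<Rightarrow> nat \<Rightarrow> 'o \<Rightarrow> 'a"
    and W :: "nat \<Rightarrow> nat \<Rightarrow> nat \<Rightarrow> 'o \<Rightarrow> 'w"
    and sel :: "nat \<Rightarrow> 'o \<Rightarrow> nat"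
  assumes f_meas: "case_prod f \<in> borel_measurable (restrict_space borel D \<Otimes>\<^sub>M N)"
    \<comment> \<open>The integral of a non-integrable function is 0, so the variance bound alone
      would not exclude infinite variance.\<close>
    and f_sq: "\<And>x. x \<in> D \<Longrightarrow> integrable N (\<lambda>w. (f x w)\<^sup>2)"
    and f_var: "\<And>x. x \<in> D \<Longrightarrow> noise.variance (f x) \<le> 1"
    and xstar: "xstar \<in> D"
    and xt_meas: "\<And>i n. i \<in> {1..M} \<Longrightarrow> n \<ge> 1 \<Longrightarrow> xt i n \<in> measurable P (restrict_space borel D)"
    and lag: "lag_function lag"
    and r_mono: "mono_on {1..} r" and r_ge: "\<And>n. n \<ge> 1 \<Longrightarrow> r n \<ge> 1"
    and s_ge: "\<And>n. n \<ge> 1 \<Longrightarrow> s n \<ge> 1"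
    and lag_lim: "filterlim (\<lambda>n. lag (r n)) at_top sequentially"
    and W_distr: "\<And>n i j. (n, i, j) \<in> comparison_indices M s \<Longrightarrow> distr P N (W n i j) = N"
    and W_indep: "P.indep_vars (\<lambda>_. N) (\<lambda>(n, i, j). W n i j) (comparison_indices M s)"
    and fresh: "P.indep_set (sets (solver_algebra P D M xt)) (sets (comparison_algebra P N M s W))"
    and selection: "inopa_selection P f M lag r s xt W sel"
    and eps_pos: "\<And>n. n \<ge> 1 \<Longrightarrow> \<epsilon> n > 0"
begin

abbreviation "R \<equiv> simple_regret N f xstar xt"
abbreviation "F \<equiv> solver_algebra P D M xt"
abbreviation "\<mu> x \<equiv> noise.expectation (f x)"
abbreviation "T \<equiv> Pi\<^sub>M (comparison_indices M s) (\<lambda>_. N)"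

text \<open>All comparison noise as one random element of a product space. It is the map that
  generates \<open>comparison_algebra\<close>, so \<open>fresh\<close> is precisely its independence
  of \<open>F\<close>.\<close>

definition noise_tuple :: "'o \<Rightarrow> nat \<times> nat \<times> nat \<Rightarrow> 'w"
  where "noise_tuple = (\<lambda>\<omega>. \<lambda>(n, i, j)\<in>comparison_indices M s. W n i j \<omega>)"

text \<open>The outcome that fixes the points is separated from the noise \<open>y\<close>, so that
  one can be frozen while the other varies. The actual run is the diagonal case
  \<open>y = noise_tuple \<omega>\<close>.\<close>

definition accurate :: "nat \<Rightarrow> 'o \<Rightarrow> (nat \<times> nat \<times> nat \<Rightarrow> 'w) \<Rightarrow> nat \<Rightarrow> bool"
  where "accurate n \<omega> y i \<longleftrightarrow>
    \<bar>empirical_mean f (\<lambda>n i j y. y (n, i, j)) s n i y (xt i (lag (r n)) \<omega>) - \<mu> (xt i (lag (r n)) \<omega>)\<bar>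
      < \<epsilon> (lag (r n))"

definition all_accurate :: "nat \<Rightarrow> 'o \<Rightarrow> (nat \<times> nat \<times> nat \<Rightarrow> 'w) \<Rightarrow> bool"
  where "all_accurate n \<omega> y \<longleftrightarrow> (\<forall>i\<in>{1..M}. accurate n \<omega> y i)"

lemma lag_r_ge: "n \<ge> 1 \<Longrightarrow> lag (r n) \<ge> 1" and lag_r_le: "n \<ge> 1 \<Longrightarrow> lag (r n) \<le> r n"
  using lag r_ge by (auto simp: lag_function_def)

lemma W_meas: "(n, i, j) \<in> comparison_indices M s \<Longrightarrow> W n i j \<in> measurable P N"
  using W_indep by (auto simp: P.indep_vars_def)

lemma noise_tuple_meas: "noise_tuple \<in> measurable P T"
  unfolding noise_tuple_def by (rule measurable_restrict) (auto simp: W_meas split: prod.split)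

lemma f_slice_meas: "x \<in> D \<Longrightarrow> f x \<in> borel_measurable N"
  using measurable_compose[OF measurable_Pair1' f_meas, of x] by (simp add: space_restrict_space)

lemma f_int: "x \<in> D \<Longrightarrow> integrable N (f x)"
  using noise.square_integrable_imp_integrable f_slice_meas f_sq by blast

lemma xt_in: "i \<in> {1..M} \<Longrightarrow> n \<ge> 1 \<Longrightarrow> \<omega> \<in> space P \<Longrightarrow> xt i n \<omega> \<in> D"
  using measurable_space[OF xt_meas] by (auto simp: space_restrict_space)

lemma regret_eq: "i \<in> {1..M} \<Longrightarrow> n \<ge> 1 \<Longrightarrow> \<omega> \<in> space P \<Longrightarrow> R \<omega> i n = \<mu> (xt i n \<omega>) - \<mu> xstar"
  unfolding simple_regret_def by (simp add: f_int xt_in xstar)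

lemma sel_in: "n \<ge> 1 \<Longrightarrow> \<omega> \<in> space P \<Longrightarrow> sel n \<omega> \<in> {1..M}"
  using selection by (auto simp: inopa_selection_def is_arg_min_def)

lemma subalgebra_solver: "subalgebra P F"
proof -
  have "(\<lambda>\<omega>. \<lambda>(i, n)\<in>{1..M} \<times> {1..}. xt i n \<omega>)
      \<in> measurable P (Pi\<^sub>M ({1..M} \<times> {1..}) (\<lambda>_. restrict_space borel D))"
    by (rule measurable_restrict) (auto simp: xt_meas split: prod.split)
  from sets_image_in_sets[OF refl this] show ?thesis
    by (simp add: subalgebra_def solver_algebra_def)
qed

lemma xt_meas_F: "i \<in> {1..M} \<Longrightarrow> n \<ge> 1 \<Longrightarrow> xt i n \<in> measurable F (restrict_space borel D)"
proof -
  assume i: "i \<in> {1..M}" and n: "n \<ge> 1"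
  let ?I = "{1..M} \<times> {1..}"
  have "(\<lambda>\<omega>. \<lambda>(i, n)\<in>?I. xt i n \<omega>) \<in> measurable F (Pi\<^sub>M ?I (\<lambda>_. restrict_space borel D))"
    unfolding solver_algebra_def
    by (rule measurable_vimage_algebra1)
      (auto simp: space_PiM PiE_iff space_restrict_space xt_in)
  from measurable_compose[OF this measurable_component_singleton[of "(i, n)"]] i n
  show ?thesis by simp
qed

lemma R_meas: "i \<in> {1..M} \<Longrightarrow> n \<ge> 1 \<Longrightarrow> (\<lambda>\<omega>. R \<omega> i n) \<in> borel_measurable F"
proof -
  assume i: "i \<in> {1..M}" and n: "n \<ge> 1"
  note f_meas [measurable] and f_slice_meas[OF xstar, measurable]
  have "(\<lambda>x. LINT w|N. f x w - f xstar w) \<in> borel_measurable (restrict_space borel D)"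
    by measurable
  from measurable_compose[OF xt_meas_F[OF i n] this] show ?thesis
    by (simp add: simple_regret_def)
qed

lemma \<mu>_meas: "\<mu> \<in> borel_measurable (restrict_space borel D)"
proof -
  note f_meas [measurable]
  show ?thesis by measurable
qed

lemma solvers_regret_meas: "n \<ge> 1 \<Longrightarrow> (\<lambda>\<omega>. solvers_regret M (R \<omega>) n) \<in> borel_measurable F"
  unfolding solvers_regret_def by (rule borel_measurable_Min) (auto simp: R_meas)

lemma regret_gap_meas:
  "i \<in> {1..M} \<Longrightarrow> n \<ge> 1 \<Longrightarrow> (\<lambda>\<omega>. regret_gap M (R \<omega>) i n) \<in> borel_measurable F"
  unfolding regret_gap_def using R_meas solvers_regret_meas by auto

lemma gap_pred:
  assumes "i \<in> {1..M}" "n \<ge> 1"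
  shows "Measurable.pred F (\<lambda>\<omega>. regret_gap M (R \<omega>) i n < 2 * \<epsilon> n)"
proof -
  note regret_gap_meas[OF assms, measurable]
  show ?thesis by measurable
qed

lemma stable_from_pred:
  assumes "k \<ge> 1"
  shows "Measurable.pred F (\<lambda>\<omega>. stable_from M \<epsilon> (R \<omega>) k)"
proof -
  \<comment> \<open>The ranges are written as sets so that the gap is examined only at indices from
    \<open>k\<close> \<ge> 1 on, where its measurability is known.\<close>
  have "Measurable.pred F (\<lambda>\<omega>. \<forall>i\<in>{1..M}. \<forall>n\<in>{k..}. regret_gap M (R \<omega>) i n < 2 * \<epsilon> n \<longrightarrow>
      (\<forall>m\<in>{n..}. regret_gap M (R \<omega>) i m < 2 * \<epsilon> m))"
    by (intro pred_intros_finite(3) pred_intros_countable_bounded(3) pred_intros_logic(4) gap_pred)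
      (use assms in auto)
  then show ?thesis unfolding stable_from_def Ball_def atLeast_iff .
qed

lemma near_optimal_pred: "Measurable.pred F (\<lambda>\<omega>. i \<in> near_optimal_solvers M \<epsilon> (R \<omega>))"
proof (cases "i \<in> {1..M}")
  case True
  have "Measurable.pred F (\<lambda>\<omega>. \<exists>k\<in>{1..}. \<forall>n\<in>{k..}. regret_gap M (R \<omega>) i n < 2 * \<epsilon> n)"
    by (intro pred_intros_countable_bounded gap_pred) (use True in auto)
  moreover have "i \<in> near_optimal_solvers M \<epsilon> (R \<omega>) \<longleftrightarrow>
      (\<exists>k\<in>{1..}. \<forall>n\<in>{k..}. regret_gap M (R \<omega>) i n < 2 * \<epsilon> n)" for \<omega>
    using True by (simp add: near_optimal_solvers_def Bex_def Ball_def)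
  ultimately show ?thesis by (simp only:)
next
  case False
  then have eq: "(\<lambda>\<omega>. i \<in> near_optimal_solvers M \<epsilon> (R \<omega>)) = (\<lambda>\<omega>. False)"
    by (auto simp: near_optimal_solvers_def)
  show ?thesis unfolding eq by simp
qed

lemma card_near_optimal_meas:
  "(\<lambda>\<omega>. card (near_optimal_solvers M \<epsilon> (R \<omega>))) \<in> measurable F (count_space UNIV)"
proof -
  have eq: "card (near_optimal_solvers M \<epsilon> R') =
      (\<Sum>i=1..M. if i \<in> near_optimal_solvers M \<epsilon> R' then 1 else 0)" for R'
    using near_optimal_solvers_subset[of M \<epsilon> R'] by (simp add: sum.If_cases Int_absorb1)
  note near_optimal_pred [measurable]
  show ?thesis unfolding eq by measurable
qed

lemma sel_meas: "n \<ge> 1 \<Longrightarrow> sel n \<in> measurable P (count_space UNIV)"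
  using selection by (simp add: inopa_selection_def)

lemma success_pred:
  assumes n: "n \<ge> 1"
  shows "Measurable.pred P (\<lambda>\<omega>. selection_success M \<epsilon> r (R \<omega>) (\<lambda>k. sel k \<omega>) n)"
proof -
  note sel_meas[OF n, measurable]
  \<comment> \<open>The solver index is random; splitting over its finitely many values makes it
    constant on each piece.\<close>
  have "Measurable.pred P (\<lambda>\<omega>. \<exists>i\<in>{1..M}. sel n \<omega> = i \<and> regret_gap M (R \<omega>) i (r n) < 2 * \<epsilon> (r n))"
  proof (intro pred_intros_finite pred_intros_logic)
    fix i assume "i \<in> {1..M}"
    then show "Measurable.pred P (\<lambda>\<omega>. regret_gap M (R \<omega>) i (r n) < 2 * \<epsilon> (r n))"
      using measurable_from_subalg[OF subalgebra_solver gap_pred] r_ge n by blast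
    show "Measurable.pred P (\<lambda>\<omega>. sel n \<omega> = i)" by measurable
  qed simp
  then show ?thesis
    by (rule measurable_cong[THEN iffD1, rotated])
      (use sel_in[OF n] in \<open>auto simp: selection_success_iff\<close>)
qed

lemma evals_after_stage_meas:
  "(\<lambda>\<omega>. evals_after_stage lag r (\<lambda>k. sel k \<omega>) n i) \<in> measurable P (count_space UNIV)"
proof (induction n)
  case (Suc n)
  note Suc.IH [measurable] and sel_meas[of "Suc n", simplified, measurable]
  show ?case by (simp add: stage_evals_def Let_def)
qed simp

lemma total_evals_meas:
  assumes n: "n \<ge> 1"
  shows "(\<lambda>\<omega>. total_evals M lag r s (\<lambda>k. sel k \<omega>) n) \<in> measurable P (count_space UNIV)"
proof -
  note evals_after_stage_meas [measurable] and sel_meas[OF n, measurable]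
  show ?thesis unfolding total_evals_def stage_evals_def Let_def by measurable
qed

section \<open>From accurate comparisons to success and budget\<close>

text \<open>The selected solver has an empirical mean no larger than that of the best solver
  \<open>j\<close>, and each of the two means errs by less than \<epsilon>. The expectation at
  \<open>xstar\<close> cancels in the gap.\<close>

lemma all_accurate_gap:
  assumes n: "n \<ge> 1" and \<omega>: "\<omega> \<in> space P" and acc: "all_accurate n \<omega> (noise_tuple \<omega>)"
  shows "regret_gap M (R \<omega>) (sel n \<omega>) (lag (r n)) < 2 * \<epsilon> (lag (r n))"
proof -
  let ?m = "\<lambda>i. empirical_mean f W s n i \<omega> (xt i (lag (r n)) \<omega>)"
  let ?i = "sel n \<omega>"
  have i: "?i \<in> {1..M}" using sel_in n \<omega> .
  then obtain j where j: "j \<in> {1..M}" "solvers_regret M (R \<omega>) (lag (r n)) = R \<omega> j (lag (r n))"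
    using solvers_regret_attained[of M "R \<omega>"] by fastforce
  have "empirical_mean f (\<lambda>n i j y. y (n, i, j)) s n i (noise_tuple \<omega>) x
      = empirical_mean f W s n i \<omega> x" if "i \<in> {1..M}" for i x
    unfolding empirical_mean_def noise_tuple_def
    using n that by (auto simp: comparison_indices_def intro!: sum.cong arg_cong2[where f="(/)"])
  then have acc': "\<bar>?m i - \<mu> (xt i (lag (r n)) \<omega>)\<bar> < \<epsilon> (lag (r n))" if "i \<in> {1..M}" for i
    using acc that by (simp add: all_accurate_def accurate_def)
  have "?m ?i \<le> ?m j"
    using selection n \<omega> j(1) by (auto simp: inopa_selection_def is_arg_min_linorder)
  then have "\<mu> (xt ?i (lag (r n)) \<omega>) - \<mu> (xt j (lag (r n)) \<omega>) < 2 * \<epsilon> (lag (r n))"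
    using acc'[OF i] acc'[OF j(1)] by linarith
  then show ?thesis
    unfolding regret_gap_def j(2) using regret_eq lag_r_ge n \<omega> i j(1) by simp
qed

text \<open>The point is that \<open>n0\<close> depends on \<open>k\<close> and not on the outcome,
  so for fixed \<open>n\<close> the implication holds on the whole event of stability from
  \<open>k\<close>.\<close>

lemma eventually_success:
  assumes k: "k \<ge> 1"
  obtains n0 where "n0 \<ge> 1"
    "\<And>n \<omega>. n \<ge> n0 \<Longrightarrow> \<omega> \<in> space P \<Longrightarrow> stable_from M \<epsilon> (R \<omega>) k \<Longrightarrow> all_accurate n \<omega> (noise_tuple \<omega>) \<Longrightarrow>
      selection_success M \<epsilon> r (R \<omega>) (\<lambda>k. sel k \<omega>) n \<and>
      sel n \<omega> \<in> near_optimal_solvers M \<epsilon> (R \<omega>) \<and>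
      ((\<forall>k\<in>{1..<n}. lag (r n) < r (Suc k) \<longrightarrow> selection_success M \<epsilon> r (R \<omega>) (\<lambda>k. sel k \<omega>) k) \<longrightarrow>
        real (total_evals M lag r s (\<lambda>k. sel k \<omega>) n)
          \<le> eval_budget M (card (near_optimal_solvers M \<epsilon> (R \<omega>))) lag r s n)"
proof -
  have ev: "eventually (\<lambda>n. lag (r n) \<ge> b) sequentially" for b
    using lag_lim by (simp add: filterlim_at_top)
  \<comment> \<open>From comparison \<open>K\<close> on, \<open>r\<close> is past the stability
    threshold. Once \<open>lag (r n)\<close> has reached \<open>r K\<close>, the earlier stages with
    target beyond \<open>lag (r n)\<close> all come from comparison \<open>K\<close> on.\<close>
  obtain K where K: "K \<ge> 1" "lag (r K) \<ge> k"
    using eventually_conj[OF ev[of k] eventually_ge_at_top[of 1]]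
    by (auto dest: eventually_happens)
  have rK: "r K \<ge> k" using K lag_r_le le_trans by blast
  obtain n0 where n0: "\<And>n. n \<ge> n0 \<Longrightarrow> lag (r n) \<ge> r K"
    using ev[of "r K"] by (auto simp: eventually_sequentially)
  show ?thesis
  proof (rule that[of "max 1 n0"])
    fix n \<omega>
    assume "n \<ge> max 1 n0" and \<omega>: "\<omega> \<in> space P" and st: "stable_from M \<epsilon> (R \<omega>) k"
      and acc: "all_accurate n \<omega> (noise_tuple \<omega>)"
    then have n: "n \<ge> 1" and lr: "lag (r n) \<ge> r K" using n0 by auto
    let ?S = "near_optimal_solvers M \<epsilon> (R \<omega>)"
    have gap: "regret_gap M (R \<omega>) (sel n \<omega>) (lag (r n)) < 2 * \<epsilon> (lag (r n))"
      by (rule all_accurate_gap[OF n \<omega> acc])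
    have lk: "lag (r n) \<ge> k" using lr rK by simp
    have succ: "selection_success M \<epsilon> r (R \<omega>) (\<lambda>k. sel k \<omega>) n"
      using st gap lk lag_r_le[OF n] sel_in[OF n \<omega>] by (auto simp: stable_from_def selection_success_iff)
    have sel_S: "sel n \<omega> \<in> ?S"
      by (rule near_optimal_solversI[OF st sel_in[OF n \<omega>] k lk gap])
    have "real (total_evals M lag r s (\<lambda>k. sel k \<omega>) n) \<le> eval_budget M (card ?S) lag r s n"
      if early: "\<forall>k\<in>{1..<n}. lag (r n) < r (Suc k) \<longrightarrow> selection_success M \<epsilon> r (R \<omega>) (\<lambda>k. sel k \<omega>) k"
    proof (rule total_evals_le_budget[OF lag r_mono r_ge near_optimal_solvers_subset n])
      fix m assume m: "m \<in> {1..<n}" "lag (r n) < r (Suc m)"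
      then have "r K < r (Suc m)" using lr by simp
      \<comment> \<open>Were \<open>m\<close> smaller than \<open>K\<close>, monotonicity would give
        \<open>r (Suc m)\<close> \<le> \<open>r K\<close>.\<close>
      then have "K \<le> m" using mono_onD[OF r_mono, of "Suc m" K] K(1) by fastforce
      then have "r m \<ge> k" using mono_onD[OF r_mono, of K m] K(1) rK by fastforce
      moreover have "regret_gap M (R \<omega>) (sel m \<omega>) (r m) < 2 * \<epsilon> (r m)"
        using early m by (simp add: selection_success_iff)
      ultimately show "sel m \<omega> \<in> ?S"
        using near_optimal_solversI[OF st sel_in k] m(1) \<omega> by auto
    qed (use sel_S in auto)
    then show "selection_success M \<epsilon> r (R \<omega>) (\<lambda>k. sel k \<omega>) n \<and> sel n \<omega> \<in> ?S \<and>
      ((\<forall>k\<in>{1..<n}. lag (r n) < r (Suc k) \<longrightarrow> selection_success M \<epsilon> r (R \<omega>) (\<lambda>k. sel k \<omega>) k) \<longrightarrow>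
        real (total_evals M lag r s (\<lambda>k. sel k \<omega>) n) \<le> eval_budget M (card ?S) lag r s n)"
      using succ sel_S by blast
  qed simp
qed

section \<open>Probability of accurate comparisons\<close>

lemma W_integral:
  fixes g :: "'w \<Rightarrow> real"
  assumes "(n, i, j) \<in> comparison_indices M s" and "g \<in> borel_measurable N"
  shows "P.expectation (\<lambda>\<omega>. g (W n i j \<omega>)) = noise.expectation g"
    and "integrable N g \<Longrightarrow> integrable P (\<lambda>\<omega>. g (W n i j \<omega>))"
  using integral_distr[OF W_meas[OF assms(1)] assms(2)]
    integrable_distr[OF W_meas[OF assms(1)], of g] W_distr[OF assms(1)] by simp_all

text \<open>With the outcome \<open>x\<close> frozen, the evaluated point \<open>z\<close> is
  deterministic, and the \<open>s n\<close> evaluations are independent with mean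
  \<open>\<mu> z\<close> and variance at most 1. Their sum has variance at most \<open>s n\<close>,
  and Chebyshev's inequality is applied at deviation \<open>s n\<close> times \<epsilon>.\<close>

lemma prob_not_accurate:
  assumes n: "n \<ge> 1" and i: "i \<in> {1..M}" and x: "x \<in> space P"
  shows "P.prob {\<omega> \<in> space P. \<not> accurate n x (noise_tuple \<omega>) i} \<le> 1 / (real (s n) * (\<epsilon> (lag (r n)))\<^sup>2)"
proof -
  define z where "z = xt i (lag (r n)) x"
  define e where "e = \<epsilon> (lag (r n))"
  have z: "z \<in> D" unfolding z_def using xt_in[OF i _ x] lag_r_ge[OF n] by simp
  have e: "e > 0" unfolding e_def using eps_pos lag_r_ge n by simp
  have sn: "real (s n) > 0" using s_ge[OF n] by simp
  note fz = f_slice_meas[OF z]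
  let ?K = "(\<lambda>j. (n, i, j)) ` {1..s n}"
  \<comment> \<open>Indexing by full triples lets independence come from restricting
    \<open>W_indep\<close> to a subfamily.\<close>
  define Z where "Z p \<omega> = f z ((case p of (n, i, j) \<Rightarrow> W n i j) \<omega>)" for p \<omega>
  have K: "?K \<subseteq> comparison_indices M s" using n i by (auto simp: comparison_indices_def)
  have ind: "P.indep_vars (\<lambda>_. borel) Z ?K"
    unfolding Z_def
    by (rule P.indep_vars_compose2[OF P.indep_vars_subset[OF W_indep K]]) (rule fz)
  have Z_eq: "Z (n, i, j) = (\<lambda>\<omega>. f z (W n i j \<omega>))" for j by (simp add: Z_def fun_eq_iff)
  have Kj: "(n, i, j) \<in> comparison_indices M s" if "j \<in> {1..s n}" for j using K that by auto
  have sq: "integrable P (\<lambda>\<omega>. (Z p \<omega>)\<^sup>2)" and int: "integrable P (Z p)"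
    and mean: "P.expectation (Z p) = \<mu> z" and var: "P.variance (Z p) \<le> 1" if p: "p \<in> ?K" for p
  proof -
    obtain j where j: "j \<in> {1..s n}" "p = (n, i, j)" using p by blast
    note Wj = W_integral[OF Kj[OF j(1)]]
    show "integrable P (\<lambda>\<omega>. (Z p \<omega>)\<^sup>2)"
      unfolding j(2) Z_eq by (rule Wj(2)) (use fz f_sq[OF z] in auto)
    show "integrable P (Z p)" unfolding j(2) Z_eq by (rule Wj(2)) (use fz f_int[OF z] in auto)
    show mean: "P.expectation (Z p) = \<mu> z" unfolding j(2) Z_eq by (rule Wj(1)) (rule fz)
    have "P.variance (Z p) = noise.variance (f z)"
      unfolding mean unfolding j(2) Z_eq by (rule Wj(1)) (use fz in measurable)
    then show "P.variance (Z p) \<le> 1" using f_var[OF z] by simp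
  qed
  let ?S = "\<lambda>\<omega>. \<Sum>p\<in>?K. Z p \<omega>"
  have cardK: "card ?K = s n" by (simp add: card_image inj_on_def)
  have vs: "integrable P (\<lambda>\<omega>. (?S \<omega>)\<^sup>2)" "P.variance ?S = (\<Sum>p\<in>?K. P.variance (Z p))"
    using P.variance_sum_indep_vars[OF _ ind] sq by auto
  have S_var: "P.variance ?S \<le> real (s n)"
    unfolding vs(2) using sum_mono[of ?K "\<lambda>p. P.variance (Z p)" "\<lambda>_. 1"] var cardK by simp
  have S_mean: "P.expectation ?S = real (s n) * \<mu> z"
    using int mean cardK by (simp add: Bochner_Integration.integral_sum)
  have event_eq: "{\<omega> \<in> space P. \<not> accurate n x (noise_tuple \<omega>) i} =
      {\<omega> \<in> space P. \<bar>?S \<omega> - P.expectation ?S\<bar> \<ge> real (s n) * e}"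
  proof (rule Collect_cong, rule conj_cong[OF refl])
    fix \<omega>
    have "empirical_mean f (\<lambda>n i j y. y (n, i, j)) s n i (noise_tuple \<omega>) z = ?S \<omega> / real (s n)"
      unfolding empirical_mean_def
      by (subst sum.reindex) (use Kj in \<open>auto simp: inj_on_def noise_tuple_def Z_def intro!: sum.cong\<close>)
    then have "\<not> accurate n x (noise_tuple \<omega>) i \<longleftrightarrow> e \<le> \<bar>?S \<omega> / real (s n) - \<mu> z\<bar>"
      by (simp add: accurate_def z_def[symmetric] e_def[symmetric] not_less)
    also have "?S \<omega> / real (s n) - \<mu> z = (?S \<omega> - real (s n) * \<mu> z) / real (s n)"
      using sn by (simp add: field_simps)
    also have "e \<le> \<bar>(?S \<omega> - real (s n) * \<mu> z) / real (s n)\<bar> \<longleftrightarrow>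
        real (s n) * e \<le> \<bar>?S \<omega> - real (s n) * \<mu> z\<bar>"
      using sn by (simp add: abs_divide pos_le_divide_eq mult.commute)
    finally show "\<not> accurate n x (noise_tuple \<omega>) i \<longleftrightarrow>
        \<bar>?S \<omega> - P.expectation ?S\<bar> \<ge> real (s n) * e" unfolding S_mean .
  qed
  have "P.prob {\<omega> \<in> space P. \<not> accurate n x (noise_tuple \<omega>) i} \<le> P.variance ?S / (real (s n) * e)\<^sup>2"
    unfolding event_eq
  proof (rule P.Chebyshev_inequality)
    show "?S \<in> borel_measurable P" by (rule borel_measurable_sum) (rule borel_measurable_integrable[OF int])
    show "0 < real (s n) * e" using sn e by simp
  qed (rule vs(1))
  also have "\<dots> \<le> real (s n) / (real (s n) * e)\<^sup>2"
    by (rule divide_right_mono[OF S_var]) simp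
  also have "\<dots> = 1 / (real (s n) * e\<^sup>2)" using sn by (simp add: power2_eq_square)
  finally show ?thesis unfolding e_def .
qed

lemma accurate_meas:
  assumes n: "n \<ge> 1" and i: "i \<in> {1..M}"
  shows "Measurable.pred (F \<Otimes>\<^sub>M T) (\<lambda>(\<omega>, y). accurate n \<omega> y i)"
proof -
  have x: "(\<lambda>p. xt i (lag (r n)) (fst p)) \<in> measurable (F \<Otimes>\<^sub>M T) (restrict_space borel D)"
    by (rule measurable_compose[OF measurable_fst xt_meas_F[OF i lag_r_ge[OF n]]])
  have f [measurable]: "(\<lambda>p. f (xt i (lag (r n)) (fst p)) (snd p (n, i, j))) \<in> borel_measurable (F \<Otimes>\<^sub>M T)"
    if "j \<in> {1..s n}" for j
  proof -
    have "(n, i, j) \<in> comparison_indices M s" using n i that by (auto simp: comparison_indices_def)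
    then have "(\<lambda>p. snd p (n, i, j)) \<in> measurable (F \<Otimes>\<^sub>M T) N"
      by (intro measurable_compose[OF measurable_snd] measurable_component_singleton)
    from measurable_compose[OF measurable_Pair[OF x this] f_meas] show ?thesis by simp
  qed
  have \<mu> [measurable]: "(\<lambda>p. \<mu> (xt i (lag (r n)) (fst p))) \<in> borel_measurable (F \<Otimes>\<^sub>M T)"
    by (rule measurable_compose[OF x \<mu>_meas])
  have m [measurable]: "(\<lambda>p. \<Sum>j=1..s n. f (xt i (lag (r n)) (fst p)) (snd p (n, i, j)))
      \<in> borel_measurable (F \<Otimes>\<^sub>M T)"
    by (rule borel_measurable_sum) (rule f)
  have "Measurable.pred (F \<Otimes>\<^sub>M T)
      (\<lambda>p. \<bar>(\<Sum>j=1..s n. f (xt i (lag (r n)) (fst p)) (snd p (n, i, j))) / real (s n)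
        - \<mu> (xt i (lag (r n)) (fst p))\<bar> < \<epsilon> (lag (r n)))"
    by measurable
  then show ?thesis unfolding accurate_def empirical_mean_def case_prod_beta .
qed

lemma all_accurate_meas:
  assumes "n \<ge> 1"
  shows "Measurable.pred (F \<Otimes>\<^sub>M T) (\<lambda>(\<omega>, y). all_accurate n \<omega> y)"
proof -
  have "Measurable.pred (F \<Otimes>\<^sub>M T) (\<lambda>p. \<forall>i\<in>{1..M}. case p of (\<omega>, y) \<Rightarrow> accurate n \<omega> y i)"
    by (intro pred_intros_finite(3) accurate_meas assms) auto
  then show ?thesis unfolding all_accurate_def case_prod_beta .
qed

lemma noise_indep: "P.indep_set (sets F) (sets (vimage_algebra (space P) noise_tuple T))"
  using fresh unfolding comparison_algebra_def noise_tuple_def .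

lemma noise_section_meas:
  assumes "n \<ge> 1" and "x \<in> space P"
  shows "Measurable.pred P (\<lambda>\<omega>. all_accurate n x (noise_tuple \<omega>))"
    and "i \<in> {1..M} \<Longrightarrow> Measurable.pred P (\<lambda>\<omega>. accurate n x (noise_tuple \<omega>) i)"
proof -
  have x: "x \<in> space F" using subalgebra_solver assms by (simp add: subalgebra_def)
  show "Measurable.pred P (\<lambda>\<omega>. all_accurate n x (noise_tuple \<omega>))"
    using measurable_compose[OF noise_tuple_meas measurable_compose_Pair1[OF x all_accurate_meas[OF assms(1)]]]
    by simp
  show "Measurable.pred P (\<lambda>\<omega>. accurate n x (noise_tuple \<omega>) i)" if "i \<in> {1..M}"
    using measurable_compose[OF noise_tuple_meas measurable_compose_Pair1[OF x accurate_meas[OF assms(1) that]]]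
    by simp
qed

lemma prob_all_accurate:
  assumes n: "n \<ge> 1" and x: "x \<in> space P"
  shows "P.prob {\<omega> \<in> space P. all_accurate n x (noise_tuple \<omega>)}
    \<ge> 1 - real M / (real (s n) * (\<epsilon> (lag (r n)))\<^sup>2)"
proof -
  let ?B = "\<lambda>i. {\<omega> \<in> space P. \<not> accurate n x (noise_tuple \<omega>) i}"
  have meas: "?B i \<in> P.events" if "i \<in> {1..M}" for i
    using pred_intros_logic(2)[OF noise_section_meas(2)[OF n x that]] by (simp add: pred_def)
  have "P.prob (\<Union>i\<in>{1..M}. ?B i) \<le> (\<Sum>i\<in>{1..M}. P.prob (?B i))"
    by (rule P.finite_measure_subadditive_finite) (use meas in auto)
  also have "\<dots> \<le> (\<Sum>i\<in>{1..M}. 1 / (real (s n) * (\<epsilon> (lag (r n)))\<^sup>2))"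
    by (rule sum_mono) (rule prob_not_accurate[OF n _ x])
  also have "\<dots> = real M / (real (s n) * (\<epsilon> (lag (r n)))\<^sup>2)" by simp
  finally have *: "P.prob (\<Union>i\<in>{1..M}. ?B i) \<le> real M / (real (s n) * (\<epsilon> (lag (r n)))\<^sup>2)" .
  have "{\<omega> \<in> space P. all_accurate n x (noise_tuple \<omega>)} = space P - (\<Union>i\<in>{1..M}. ?B i)"
    by (auto simp: all_accurate_def)
  moreover have "(\<Union>i\<in>{1..M}. ?B i) \<in> P.events" using meas by blast
  ultimately show ?thesis using * by (simp add: P.prob_compl)
qed

definition accurate_event :: "nat \<Rightarrow> 'o set"
  where "accurate_event n = {\<omega> \<in> space P. all_accurate n \<omega> (noise_tuple \<omega>)}"

sublocale FM: finite_measure_subalgebra P F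
  by unfold_locales (rule subalgebra_solver)

lemma accurate_event_in: "n \<ge> 1 \<Longrightarrow> accurate_event n \<in> P.events"
proof -
  assume n: "n \<ge> 1"
  have "(\<lambda>\<omega>. (\<omega>, noise_tuple \<omega>)) \<in> measurable P (F \<Otimes>\<^sub>M T)"
    using measurable_from_subalg[OF subalgebra_solver, of "\<lambda>\<omega>. \<omega>" F] noise_tuple_meas
    by (intro measurable_Pair) simp_all
  from measurable_compose[OF this all_accurate_meas[OF n]] show ?thesis
    by (simp add: accurate_event_def pred_def)
qed

text \<open>The bound holds for every frozen outcome, hence conditionally on \<open>F\<close>. The
  conditional form survives restriction to a stability event, which lies in \<open>F\<close>; a
  bound on the plain probability would not.\<close>

lemma cond_prob_accurate:
  assumes n: "n \<ge> 1"
  shows "AE \<omega> in P. real_cond_exp P F (indicator (accurate_event n)) \<omega>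
    \<ge> 1 - real M / (real (s n) * (\<epsilon> (lag (r n)))\<^sup>2)"
  using P.real_cond_exp_freeze[OF subalgebra_solver noise_tuple_meas noise_indep all_accurate_meas[OF n]] AE_space
  unfolding accurate_event_def[symmetric]
  by eventually_elim (use prob_all_accurate[OF n] in simp)

lemma prob_accurate_event:
  assumes n: "n \<ge> 1"
  shows "P.prob (accurate_event n) \<ge> 1 - real M / (real (s n) * (\<epsilon> (lag (r n)))\<^sup>2)"
proof -
  have int: "integrable P (indicator (accurate_event n) :: _ \<Rightarrow> real)"
    by (rule P.integrable_const_bound[where B=1])
      (use accurate_event_in[OF n] in \<open>auto simp: indicator_def\<close>)
  have "1 - real M / (real (s n) * (\<epsilon> (lag (r n)))\<^sup>2)
      \<le> P.expectation (real_cond_exp P F (indicator (accurate_event n)))"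
    by (rule P.integral_ge_const) (use FM.real_cond_exp_int(1)[OF int] cond_prob_accurate[OF n] in auto)
  also have "\<dots> = P.expectation (indicator (accurate_event n))"
    by (rule FM.real_cond_exp_int(2)[OF int])
  also have "\<dots> = P.prob (accurate_event n)"
    using accurate_event_in[OF n] sets.sets_into_space by (simp add: Int_absorb2)
  finally show ?thesis .
qed

lemma AE_eventually_accurate:
  assumes "summable (\<lambda>j. 1 / (real (s (Suc j)) * (\<epsilon> (lag (r (Suc j))))\<^sup>2))"
  shows "AE \<omega> in P. \<forall>\<^sub>F n in sequentially. \<omega> \<in> accurate_event n"
proof -
  \<comment> \<open>Comparisons are numbered from 1, whereas the summed sequence starts at
    0.\<close>
  let ?A = "\<lambda>j. space P - accurate_event (Suc j)"
  have bound: "P.prob (?A j) \<le> real M * (1 / (real (s (Suc j)) * (\<epsilon> (lag (r (Suc j))))\<^sup>2))" for j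
    using prob_accurate_event[of "Suc j"] accurate_event_in[of "Suc j"] by (simp add: P.prob_compl)
  have "AE \<omega> in P. \<forall>\<^sub>F j in sequentially. \<omega> \<in> space P - ?A j"
  proof (rule borel_cantelli_AE1)
    show "?A j \<in> P.events" for j using accurate_event_in[of "Suc j"] by auto
    show "emeasure P (?A j) < \<infinity>" for j by (simp add: less_top[symmetric])
    show "summable (\<lambda>j. P.prob (?A j))"
      by (rule summable_comparison_test'[OF summable_mult[OF assms, of "real M"]])
        (use bound in simp)
  qed
  then show ?thesis
    by eventually_elim
      (rule eventually_sequentially_Suc[THEN iffD1], auto elim: eventually_mono)
qed

text \<open>\<^const>\<open>real_cond_exp\<close> is a junk value for non-measurable functions.\<close>

lemma success_and_budget_event:
  assumes n: "n \<ge> 1"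
  shows "{\<omega> \<in> space P. selection_success M \<epsilon> r (R \<omega>) (\<lambda>k. sel k \<omega>) n \<and>
      ((\<forall>k\<in>{1..<n}. lag (r n) < r (Suc k) \<longrightarrow> selection_success M \<epsilon> r (R \<omega>) (\<lambda>k. sel k \<omega>) k) \<longrightarrow>
        real (total_evals M lag r s (\<lambda>k. sel k \<omega>) n)
          \<le> eval_budget M (card (near_optimal_solvers M \<epsilon> (R \<omega>))) lag r s n)} \<in> P.events"
proof -
  have c: "(\<lambda>\<omega>. card (near_optimal_solvers M \<epsilon> (R \<omega>))) \<in> measurable P (count_space UNIV)"
    by (rule measurable_from_subalg[OF subalgebra_solver card_near_optimal_meas])
  have b: "(\<lambda>\<omega>. eval_budget M (card (near_optimal_solvers M \<epsilon> (R \<omega>))) lag r s n) \<in> borel_measurable P"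
    by (rule measurable_compose[OF c]) simp
  have t: "(\<lambda>\<omega>. real (total_evals M lag r s (\<lambda>k. sel k \<omega>) n)) \<in> borel_measurable P"
    by (rule measurable_compose[OF total_evals_meas[OF n]]) simp
  have le: "Measurable.pred P (\<lambda>\<omega>. real (total_evals M lag r s (\<lambda>k. sel k \<omega>) n)
      \<le> eval_budget M (card (near_optimal_solvers M \<epsilon> (R \<omega>))) lag r s n)"
    using borel_measurable_le[OF t b] unfolding pred_def .
  have early: "Measurable.pred P (\<lambda>\<omega>. lag (r n) < r (Suc k) \<longrightarrow>
      selection_success M \<epsilon> r (R \<omega>) (\<lambda>k. sel k \<omega>) k)" if "k \<in> {1..<n}" for k
    by (intro pred_intros_logic(4) success_pred) (use that in auto)
  have "Measurable.pred P (\<lambda>\<omega>. selection_success M \<epsilon> r (R \<omega>) (\<lambda>k. sel k \<omega>) n \<and>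
      ((\<forall>k\<in>{1..<n}. lag (r n) < r (Suc k) \<longrightarrow> selection_success M \<epsilon> r (R \<omega>) (\<lambda>k. sel k \<omega>) k) \<longrightarrow>
        real (total_evals M lag r s (\<lambda>k. sel k \<omega>) n)
          \<le> eval_budget M (card (near_optimal_solvers M \<epsilon> (R \<omega>))) lag r s n))"
    by (rule pred_intros_logic(3)[OF success_pred[OF n]
          pred_intros_logic(4)[OF pred_intros_finite(3)[OF _ early] le]]) simp
  then show ?thesis by (simp only: pred_def)
qed

section \<open>The conditional probability bound\<close>

text \<open>On the event of stability from \<open>k\<close>, accuracy implies the desired event for
  all late \<open>n\<close>. This stability event belongs to \<open>F\<close>, so its indicator
  leaves the conditional expectation and the bound for accuracy carries over there. The final
  \<open>n0\<close> is random only through the choice of \<open>k\<close>.\<close>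

lemma cond_prob_success_and_budget:
  assumes stable: "P_as P M R \<epsilon>"
  shows "AE \<omega> in P. \<exists>n0\<ge>1. \<forall>n\<ge>n0.
    sigma_cond_prob P F
      (\<lambda>\<omega>'. selection_success M \<epsilon> r (R \<omega>') (\<lambda>k. sel k \<omega>') n \<and>
        ((\<forall>k\<in>{1..<n}. lag (r n) < r (Suc k) \<longrightarrow> selection_success M \<epsilon> r (R \<omega>') (\<lambda>k. sel k \<omega>') k) \<longrightarrow>
          real (total_evals M lag r s (\<lambda>k. sel k \<omega>') n)
            \<le> eval_budget M (card (near_optimal_solvers M \<epsilon> (R \<omega>'))) lag r s n)) \<omega>
    \<ge> 1 - real M / (real (s n) * (\<epsilon> (lag (r n)))\<^sup>2)"
    (is "AE \<omega> in P. \<exists>n0\<ge>1. \<forall>n\<ge>n0. sigma_cond_prob P F (?Q n) \<omega> \<ge> ?c n")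
proof -
  define B where "B k n \<longleftrightarrow>
    (AE \<omega> in P. stable_from M \<epsilon> (R \<omega>) k \<longrightarrow> sigma_cond_prob P F (?Q n) \<omega> \<ge> ?c n)" for k n
  have "\<exists>n0. n0 \<ge> 1 \<and> (\<forall>n\<ge>n0. B k n)" if k: "k \<ge> 1" for k
  proof -
    obtain n0 where n0: "n0 \<ge> 1" "\<And>n \<omega>. n \<ge> n0 \<Longrightarrow> \<omega> \<in> space P \<Longrightarrow> stable_from M \<epsilon> (R \<omega>) k \<Longrightarrow>
        all_accurate n \<omega> (noise_tuple \<omega>) \<Longrightarrow> ?Q n \<omega>"
      using eventually_success[OF k] by metis
    have "B k n" if "n \<ge> n0" for n
    proof -
      have n: "n \<ge> 1" using that n0(1) by simp
      define A where "A = {\<omega> \<in> space F. stable_from M \<epsilon> (R \<omega>) k}"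
      have AF: "A \<in> sets F" using stable_from_pred[OF k] unfolding A_def pred_def .
      have AP: "A \<in> P.events" using AF subalgebra_solver by (auto simp: subalgebra_def)
      note G = accurate_event_in[OF n]
      \<comment> \<open>The product form allows the \<open>F\<close>-measurable factor to be pulled
        out of the conditional expectation.\<close>
      let ?I = "\<lambda>\<omega>. indicator A \<omega> * indicator (accurate_event n) \<omega> :: real"
      have intI: "integrable P ?I"
        by (rule P.integrable_const_bound[where B=1]) (use AP G in \<open>auto simp: indicator_def\<close>)
      have intQ: "integrable P (indicator {\<omega> \<in> space P. ?Q n \<omega>} :: _ \<Rightarrow> real)"
        by (rule P.integrable_const_bound[where B=1])
          (use success_and_budget_event[OF n] in \<open>auto simp: indicator_def\<close>)
      have le: "AE \<omega> in P. ?I \<omega> \<le> indicator {\<omega> \<in> space P. ?Q n \<omega>} \<omega>"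
      proof (rule AE_I2)
        fix \<omega> assume \<omega>: "\<omega> \<in> space P"
        show "?I \<omega> \<le> indicator {\<omega> \<in> space P. ?Q n \<omega>} \<omega>"
        proof (cases "\<omega> \<in> A \<inter> accurate_event n")
          case True
          then have "?Q n \<omega>" using n0(2)[OF that \<omega>] unfolding A_def accurate_event_def by blast
          then have "\<omega> \<in> {\<omega> \<in> space P. ?Q n \<omega>}" using \<omega> by blast
          then show ?thesis by (simp only: indicator_simps) (simp add: indicator_def)
        next
          case False
          then have "?I \<omega> = 0" by (auto simp: indicator_def)
          then show ?thesis by (simp only: indicator_pos_le)
        qed
      qed
      have "AE \<omega> in P. real_cond_exp P F ?I \<omega>
          = indicator A \<omega> * real_cond_exp P F (indicator (accurate_event n)) \<omega>"
        by (rule FM.real_cond_exp_mult[OF _ _ intI]) (use AF G in auto)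
      then show ?thesis
        unfolding B_def using FM.real_cond_exp_mono[OF le intI intQ] cond_prob_accurate[OF n] AE_space
      proof eventually_elim
        case (elim \<omega>)
        show ?case
        proof
          assume "stable_from M \<epsilon> (R \<omega>) k"
          then have "\<omega> \<in> A" using elim(4) subalgebra_solver by (simp add: A_def subalgebra_def)
          then show "sigma_cond_prob P F (?Q n) \<omega> \<ge> ?c n"
            using elim(1-3) unfolding sigma_cond_prob_def by simp
        qed
      qed
    qed
    then show ?thesis using n0(1) by blast
  qed
  then obtain n0 where n0: "\<And>k. k \<ge> 1 \<Longrightarrow> n0 k \<ge> 1"
    "\<And>k n. k \<ge> 1 \<Longrightarrow> n \<ge> n0 k \<Longrightarrow> B k n"
    by metis
  \<comment> \<open>The exceptional null set depends on \<open>k\<close> and \<open>n\<close>. All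
    these countably many sets are united before \<open>k\<close> is chosen according to the
    outcome.\<close>
  have "AE \<omega> in P. k \<ge> 1 \<longrightarrow> n \<ge> n0 k \<longrightarrow> stable_from M \<epsilon> (R \<omega>) k \<longrightarrow>
      sigma_cond_prob P F (?Q n) \<omega> \<ge> ?c n" for k n
  proof (cases "k \<ge> 1 \<and> n \<ge> n0 k")
    case True
    then have "B k n" using n0(2) by blast
    then show ?thesis unfolding B_def by eventually_elim blast
  next
    case False
    then show ?thesis by (intro AE_I2) blast
  qed
  then have "AE \<omega> in P. \<forall>k n. k \<ge> 1 \<longrightarrow> n \<ge> n0 k \<longrightarrow> stable_from M \<epsilon> (R \<omega>) k \<longrightarrow>
      sigma_cond_prob P F (?Q n) \<omega> \<ge> ?c n"
    by (simp only: AE_all_countable simp_thms)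
  with AE_stable_from[OF stable] show ?thesis
  proof eventually_elim
    case (elim \<omega>)
    then obtain k where "k \<ge> 1" "stable_from M \<epsilon> (R \<omega>) k" by blast
    with elim(2) n0(1)[of k] show ?case by (intro exI[of _ "n0 k"]) blast
  qed
qed

section \<open>The almost sure statement\<close>

text \<open>The argument is pathwise: for almost every outcome all late comparisons are accurate, so
  all late selections succeed. The success of earlier selections, on which the budget was
  conditional, then holds at every stage that matters.\<close>

lemma AE_success_and_budget:
  assumes stable: "P_as P M R \<epsilon>"
    and summable: "summable (\<lambda>j. 1 / (real (s (Suc j)) * (\<epsilon> (lag (r (Suc j))))\<^sup>2))"
    and lag_o: "(\<lambda>n. real (lag n)) \<in> o(\<lambda>n. real n)"
    and s_o: "(\<lambda>n. \<Sum>j=1..n. real (s j)) \<in> o(\<lambda>n. real (r n))"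
  shows "AE \<omega> in P.
    (\<exists>n0\<ge>1. \<forall>n\<ge>n0. selection_success M \<epsilon> r (R \<omega>) (\<lambda>k. sel k \<omega>) n \<and>
      real (total_evals M lag r s (\<lambda>k. sel k \<omega>) n)
        \<le> eval_budget M (card (near_optimal_solvers M \<epsilon> (R \<omega>))) lag r s n) \<and>
    (\<lambda>n. eval_budget M (card (near_optimal_solvers M \<epsilon> (R \<omega>))) lag r s n) \<sim>[sequentially]
      (\<lambda>n. real (r n) * real (card (near_optimal_solvers M \<epsilon> (R \<omega>))))"
  using AE_stable_from[OF stable] AE_eventually_accurate[OF summable] AE_space
proof eventually_elim
  case (elim \<omega>)
  let ?S = "near_optimal_solvers M \<epsilon> (R \<omega>)"
  let ?ok = "\<lambda>n. selection_success M \<epsilon> r (R \<omega>) (\<lambda>k. sel k \<omega>) n"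
  let ?bd = "\<lambda>n. real (total_evals M lag r s (\<lambda>k. sel k \<omega>) n) \<le> eval_budget M (card ?S) lag r s n"
  obtain k where k: "k \<ge> 1" "stable_from M \<epsilon> (R \<omega>) k" using elim(1) by blast
  obtain n1 where n1: "n1 \<ge> 1" "\<And>n. n \<ge> n1 \<Longrightarrow> all_accurate n \<omega> (noise_tuple \<omega>) \<Longrightarrow>
      ?ok n \<and> sel n \<omega> \<in> ?S \<and>
      ((\<forall>k\<in>{1..<n}. lag (r n) < r (Suc k) \<longrightarrow> ?ok k) \<longrightarrow> ?bd n)"
    using eventually_success[OF k(1)] elim(3) k(2) by metis
  obtain n2 where n2: "\<And>n. n \<ge> n2 \<Longrightarrow> \<omega> \<in> accurate_event n"
    using elim(2) by (auto simp: eventually_sequentially)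
  define n3 where "n3 = max n1 n2"
  have n3: "n3 \<ge> 1" "\<And>n. n \<ge> n3 \<Longrightarrow> ?ok n" "sel n3 \<omega> \<in> ?S"
    "\<And>n. n \<ge> n3 \<Longrightarrow> (\<forall>k\<in>{1..<n}. lag (r n) < r (Suc k) \<longrightarrow> ?ok k) \<Longrightarrow> ?bd n"
    using n1 n2 unfolding n3_def accurate_event_def by auto
  \<comment> \<open>Past \<open>n4\<close>, a stage whose target exceeds \<open>lag (r n)\<close>
    has number at least \<open>n3\<close> and is thus a success.\<close>
  obtain n4 where n4: "\<And>n. n \<ge> n4 \<Longrightarrow> lag (r n) \<ge> r n3"
    using lag_lim by (auto simp: filterlim_at_top eventually_sequentially)
  have bd: "?bd n" if n: "n \<ge> max n3 n4" for n
  proof (rule n3(4))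
    show "\<forall>k\<in>{1..<n}. lag (r n) < r (Suc k) \<longrightarrow> ?ok k"
    proof (intro ballI impI)
      fix k assume k: "k \<in> {1..<n}" "lag (r n) < r (Suc k)"
      then have "r n3 < r (Suc k)" using n4[of n] n by simp
      then have "n3 \<le> k" using mono_onD[OF r_mono, of "Suc k" n3] n3(1) by fastforce
      then show "?ok k" by (rule n3(2))
    qed
  qed (use n in simp)
  \<comment> \<open>The solver selected at comparison \<open>n3\<close> witnesses that the
    near-optimal set is nonempty, as the asymptotic formula requires.\<close>
  have "card ?S \<ge> 1"
    using n3(3) near_optimal_solvers_subset[of M \<epsilon> "R \<omega>"] finite_subset[of ?S "{1..M}"]
    by (metis One_nat_def Suc_leI card_gt_0_iff empty_iff finite_atLeastAtMost)
  moreover have "filterlim r at_top sequentially"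
    by (rule filterlim_at_top_mono[OF lag_lim eventually_mono[OF eventually_ge_at_top[of 1]]])
      (rule lag_r_le)
  ultimately have "(\<lambda>n. eval_budget M (card ?S) lag r s n) \<sim>[sequentially] (\<lambda>n. real (r n) * real (card ?S))"
    using eval_budget_asymp_equiv[OF r_ge _ _ lag_o s_o] by blast
  moreover have "\<exists>n0\<ge>1. \<forall>n\<ge>n0. ?ok n \<and> ?bd n"
    using n3(1,2) bd by (intro exI[of _ "max n3 n4"]) auto
  ultimately show ?case by blast
qed

end

theorem theorem2:
  fixes P :: "'o measure" and N :: "'w measure"
    and D :: "'a::euclidean_space set" and f :: "'a \<Rightarrow> 'w \<Rightarrow> real" and xstar :: 'a
    and M :: nat and lag r s :: "nat \<Rightarrow> nat" and \<epsilon> :: "nat \<Rightarrow> real"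
    and xt :: "nat \<Rightarrow> nat \<Rightarrow> 'o \<Rightarrow> 'a"
    and W :: "nat \<Rightarrow> nat \<Rightarrow> nat \<Rightarrow> 'o \<Rightarrow> 'w"
    and sel :: "nat \<Rightarrow> 'o \<Rightarrow> nat"
  defines "R \<equiv> simple_regret N f xstar xt"
    and "F \<equiv> solver_algebra P D M xt"
    and "M' \<equiv> \<lambda>\<omega>. card (near_optimal_solvers M \<epsilon> (simple_regret N f xstar xt \<omega>))"
  assumes "prob_space P" and "prob_space N"
    \<comment> \<open>the noisy objective\<close>
    and "case_prod f \<in> borel_measurable (restrict_space borel D \<Otimes>\<^sub>M N)"
    and "\<And>x. x \<in> D \<Longrightarrow> integrable N (\<lambda>w. (f x w)\<^sup>2)"
    and "\<And>x. x \<in> D \<Longrightarrow> prob_space.variance N (f x) \<le> 1"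
    and "is_arg_min (\<lambda>x. LINT w|N. f x w) (\<lambda>x. x \<in> D) xstar"
    \<comment> \<open>solvers, lag, comparison times and numbers of resamplings\<close>
    and "M \<ge> 2"
    and "\<And>i n. i \<in> {1..M} \<Longrightarrow> n \<ge> 1 \<Longrightarrow> xt i n \<in> measurable P (restrict_space borel D)"
    and "lag_function lag"
    and "mono_on {1..} r" and "\<And>n. n \<ge> 1 \<Longrightarrow> r n \<ge> 1"
    and "mono_on {1..} s" and "\<And>n. n \<ge> 1 \<Longrightarrow> s n \<ge> 1"
    and "filterlim (\<lambda>n. lag (r n)) at_top sequentially"
    \<comment> \<open>fresh comparison noise\<close>
    and "\<And>n i j. (n, i, j) \<in> comparison_indices M s \<Longrightarrow> distr P N (W n i j) = N"
    and "prob_space.indep_vars P (\<lambda>_. N) (\<lambda>(n, i, j). W n i j) (comparison_indices M s)"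
    and "prob_space.indep_set P (sets F) (sets (comparison_algebra P N M s W))"
    and "inopa_selection P f M lag r s xt W sel"
    \<comment> \<open>the stability property\<close>
    and "\<And>n. n \<ge> 1 \<Longrightarrow> \<epsilon> n > 0"
    and "P_as P M R \<epsilon>"
  shows
    "(AE \<omega> in P. \<exists>n0\<ge>1. \<forall>n\<ge>n0.
        sigma_cond_prob P F
          (\<lambda>\<omega>'. selection_success M \<epsilon> r (R \<omega>') (\<lambda>k. sel k \<omega>') n \<and>
            ((\<forall>k\<in>{1..<n}. lag (r n) < r (Suc k) \<longrightarrow>
                selection_success M \<epsilon> r (R \<omega>') (\<lambda>k. sel k \<omega>') k) \<longrightarrow>
              real (total_evals M lag r s (\<lambda>k. sel k \<omega>') n) \<le> eval_budget M (M' \<omega>') lag r s n))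
          \<omega>
        \<ge> 1 - real M / (real (s n) * (\<epsilon> (lag (r n)))\<^sup>2))
    \<and> (summable (\<lambda>j. 1 / (real (s (Suc j)) * (\<epsilon> (lag (r (Suc j))))\<^sup>2)) \<and>
       (\<lambda>n. real (lag n)) \<in> o(\<lambda>n. real n) \<and>
       (\<lambda>n. \<Sum>j=1..n. real (s j)) \<in> o(\<lambda>n. real (r n))
       \<longrightarrow>
       (AE \<omega> in P.
          (\<exists>n0\<ge>1. \<forall>n\<ge>n0.
             selection_success M \<epsilon> r (R \<omega>) (\<lambda>k. sel k \<omega>) n \<and>
             real (total_evals M lag r s (\<lambda>k. sel k \<omega>) n) \<le> eval_budget M (M' \<omega>) lag r s n) \<and>
          (\<lambda>n. eval_budget M (M' \<omega>) lag r s n) \<sim>[sequentially]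
            (\<lambda>n. real (r n) * real (M' \<omega>))))"
proof -
  have xstar: "xstar \<in> D" using assms(9) by (simp add: is_arg_min_def)
  interpret I: inopa_run P N D f xstar M lag r s \<epsilon> xt W sel
    by (rule inopa_run.intro[OF assms(4,5)], rule inopa_run_axioms.intro;
        fact xstar assms(6-8,11-22)[unfolded F_def])
  note stable = assms(23)[unfolded R_def]
  show ?thesis
    unfolding R_def F_def M'_def
    using I.cond_prob_success_and_budget[OF stable] I.AE_success_and_budget[OF stable] by blast
qed

end
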